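(* Let $F(\lambda)$, $\lambda\in(\sigma,\tau)$, satisfy the standing assumptions (A1)–(A3) below. Suppose there are families of Hermitian quadratic forms $\mathfrak f(\lambda)[y]$ and $\mathfrak f'(\lambda)[y]$, $\lambda\in(\sigma,\tau)$, such that: (i) for every $\lambda_0$, $\mathfrak f(\lambda_0)$ is the closure of the form $y\mapsto\langle F(\lambda_0)y,y\rangle_{\mathfrak H}$ defined on $\mathfrak D(F(\lambda_0))$; (ii) the domain of $\mathfrak f(\lambda_0)$ is a subspace $\mathfrak D(\mathfrak f)$ independent of $\lambda_0$; (iii) for every $\lambda_0$, the domain of $\mathfrak f'(\lambda_0)$ is $\mathfrak D(\mathfrak f)$; (iv) the forms $\mathfrak f'(\lambda)$ are bounded uniformly in $\lambda\in(\sigma,\tau)$ with respect to a (any) norm in which $\mathfrak D(\mathfrak f)$ is complete, e.g. the form norm $\|y\|^2=\mathfrak f(\lambda_* )[y]-c\|y\|_{\mathfrak H}^2$ for a fixed $\lambda_*$ and $c$ below the lower bound of $\mathfrak f(\lambda_* )$: there is $C$ with $|\mathfrak f'(\lambda)[y]|\leqslant C\|y\|^2$ for all $\lambda$ and $y\in\mathfrak D(\mathfrak f)$; (v) for every fixed $y_0\in\mathfrak D(\mathfrak f)$ the function $\lambda\mapsto\mathfrak f(\lambda)[y_0]$ is differentiable on $(\sigma,\tau)$ with derivative $\mathfrak f'(\lambda)[y_0]$; (vi) for every eigenpair $\{\lambda_0,y_0\}$ of $F$ (i.e. $\lambda_0\in(\sigma,\tau)$, $y_0\neq 0$, $F(\lambda_0)y_0=0$)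 one has $\mathfrak f'(\lambda_0)[y_0]<0$. Then for every half-open interval $[\xi_1,\xi_2)$ with $[\xi_1,\xi_2]\subset(\sigma,\tau)$, \[ \mathcal N_F(\xi_1,\xi_2)=\nu_F(\xi_2)-\nu_F(\xi_1). \]
   Context: Standing assumptions on $F$: (A1) for every $\lambda_0\in(\sigma,\tau)$, $F(\lambda_0)$ is a self-adjoint operator in a Hilbert space $\mathfrak H$ with compact resolvent; (A2) for every $\lambda_0\in(\sigma,\tau)$ there exist a real $\mu$ and a neighbourhood $\mathcal U(\lambda_0)$ with compact closure in $(\sigma,\tau)$ such that $F(\lambda_1)-\mu\geqslant 0$ for all $\lambda_1\in\mathcal U(\lambda_0)$; (A3) $\lambda\mapsto (F(\lambda)-i)^{-1}$ is continuous on $(\sigma,\tau)$ in the operator norm. A number $\lambda_0$ is an eigenvalue of multiplicity $m$ of $F$ if $0$ is an eigenvalue of multiplicity $m$ of $F(\lambda_0)$. $\mathcal N_F(\xi_1,\xi_2)$ is the number of eigenvalues of $F$ in $[\xi_1,\xi_2)$ counted with multiplicity; $\nu_F(\lambda_0)$ is the number of negative eigenvalues of $F(\lambda_0)$ counted with multiplicity. Closure of a quadratic form is in the sense of Kato. *)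

theory Defs
  imports "HOL-Analysis.Analysis"
begin

text \<open>A complex Hilbert space is modelled by a carrier type 'h (an abelian group)
together with a complex scalar multiplication sc and an inner product ip
(linear in the first, conjugate-linear in the second argument).\<close>

definition hnorm :: "('h \<Rightarrow> 'h \<Rightarrow> complex) \<Rightarrow> 'h \<Rightarrow> real" where
  "hnorm ip x = sqrt (Re (ip x x))"

definition hconv :: "('h::ab_group_add \<Rightarrow> 'h \<Rightarrow> complex) \<Rightarrow> (nat \<Rightarrow> 'h) \<Rightarrow> 'h \<Rightarrow> bool" where
  "hconv ip s l \<longleftrightarrow> (\<lambda>n. hnorm ip (s n - l)) \<longlonglongrightarrow> 0"

definition complex_hilbert ::
  "(complex \<Rightarrow> 'h::ab_group_add \<Rightarrow> 'h) \<Rightarrow> ('h \<Rightarrow> 'h \<Rightarrow> complex) \<Rightarrow> bool" where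
  "complex_hilbert sc ip \<longleftrightarrow>
     vector_space sc \<and>
     (\<forall>x y z. ip (x + y) z = ip x z + ip y z) \<and>
     (\<forall>a x y. ip (sc a x) y = a * ip x y) \<and>
     (\<forall>x y. ip y x = cnj (ip x y)) \<and>
     (\<forall>x. x \<noteq> 0 \<longrightarrow> Re (ip x x) > 0) \<and>
     (\<forall>s. (\<forall>e>0. \<exists>N. \<forall>m\<ge>N. \<forall>n\<ge>N. hnorm ip (s m - s n) < e) \<longrightarrow> (\<exists>l. hconv ip s l))"

definition lin_op :: "(complex \<Rightarrow> 'h::ab_group_add \<Rightarrow> 'h) \<Rightarrow> 'h set \<Rightarrow> ('h \<Rightarrow> 'h) \<Rightarrow> bool" where
  "lin_op sc D A \<longleftrightarrow> module.subspace sc D \<and>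
     (\<forall>x\<in>D. \<forall>y\<in>D. A (x + y) = A x + A y) \<and>
     (\<forall>a. \<forall>x\<in>D. A (sc a x) = sc a (A x))"

definition dense_in :: "('h::ab_group_add \<Rightarrow> 'h \<Rightarrow> complex) \<Rightarrow> 'h set \<Rightarrow> bool" where
  "dense_in ip D \<longleftrightarrow> (\<forall>x. \<forall>e>0. \<exists>y\<in>D. hnorm ip (x - y) < e)"

definition adjoint_domain :: "('h \<Rightarrow> 'h \<Rightarrow> complex) \<Rightarrow> 'h set \<Rightarrow> ('h \<Rightarrow> 'h) \<Rightarrow> 'h set" where
  "adjoint_domain ip D A = {y. \<exists>z. \<forall>x\<in>D. ip (A x) y = ip x z}"

definition self_adjoint_op ::
  "(complex \<Rightarrow> 'h::ab_group_add \<Rightarrow> 'h) \<Rightarrow> ('h \<Rightarrow> 'h \<Rightarrow> complex) \<Rightarrow> 'h set \<Rightarrow> ('h \<Rightarrow> 'h) \<Rightarrow> bool" where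
  "self_adjoint_op sc ip D A \<longleftrightarrow> lin_op sc D A \<and> dense_in ip D \<and>
     adjoint_domain ip D A = D \<and> (\<forall>x\<in>D. \<forall>y\<in>D. ip (A x) y = ip x (A y))"

definition resolvent_i :: "(complex \<Rightarrow> 'h::ab_group_add \<Rightarrow> 'h) \<Rightarrow> 'h set \<Rightarrow> ('h \<Rightarrow> 'h) \<Rightarrow> 'h \<Rightarrow> 'h" where
  "resolvent_i sc D A f = (THE x. x \<in> D \<and> A x - sc \<i> x = f)"

definition compact_resolvent ::
  "(complex \<Rightarrow> 'h::ab_group_add \<Rightarrow> 'h) \<Rightarrow> ('h \<Rightarrow> 'h \<Rightarrow> complex) \<Rightarrow> 'h set \<Rightarrow> ('h \<Rightarrow> 'h) \<Rightarrow> bool" where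
  "compact_resolvent sc ip D A \<longleftrightarrow>
     (\<forall>f. \<exists>!x. x \<in> D \<and> A x - sc \<i> x = f) \<and>
     (\<forall>(s::nat \<Rightarrow> 'h) M. (\<forall>n. hnorm ip (s n) \<le> M) \<longrightarrow>
        (\<exists>r l. strict_mono r \<and> hconv ip (\<lambda>n. resolvent_i sc D A (s (r n))) l))"

definition eigenspace_op :: "(complex \<Rightarrow> 'h::ab_group_add \<Rightarrow> 'h) \<Rightarrow> 'h set \<Rightarrow> ('h \<Rightarrow> 'h) \<Rightarrow> real \<Rightarrow> 'h set" where
  "eigenspace_op sc D A \<mu> = {y \<in> D. A y = sc (complex_of_real \<mu>) y}"

definition neg_count :: "(complex \<Rightarrow> 'h::ab_group_add \<Rightarrow> 'h) \<Rightarrow> 'h set \<Rightarrow> ('h \<Rightarrow> 'h) \<Rightarrow> nat" where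
  "neg_count sc D A =
     (\<Sum>\<mu>\<in>{\<mu>. \<mu> < 0 \<and> eigenspace_op sc D A \<mu> \<noteq> {0}}. vector_space.dim sc (eigenspace_op sc D A \<mu>))"

definition nu_F :: "(complex \<Rightarrow> 'h::ab_group_add \<Rightarrow> 'h) \<Rightarrow> (real \<Rightarrow> 'h set) \<Rightarrow> (real \<Rightarrow> 'h \<Rightarrow> 'h) \<Rightarrow> real \<Rightarrow> nat" where
  "nu_F sc DF F l0 = neg_count sc (DF l0) (F l0)"

definition N_F :: "(complex \<Rightarrow> 'h::ab_group_add \<Rightarrow> 'h) \<Rightarrow> (real \<Rightarrow> 'h set) \<Rightarrow> (real \<Rightarrow> 'h \<Rightarrow> 'h) \<Rightarrow> real \<Rightarrow> real \<Rightarrow> nat" where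
  "N_F sc DF F \<xi>1 \<xi>2 =
     (\<Sum>l\<in>{l. \<xi>1 \<le> l \<and> l < \<xi>2 \<and> eigenspace_op sc (DF l) (F l) 0 \<noteq> {0}}.
        vector_space.dim sc (eigenspace_op sc (DF l) (F l) 0))"

text \<open>Hermitian forms b[x,y] with domain D; the quadratic form is Re b[y,y] (= b[y,y]).\<close>

definition hermitian_form :: "(complex \<Rightarrow> 'h::ab_group_add \<Rightarrow> 'h) \<Rightarrow> 'h set \<Rightarrow> ('h \<Rightarrow> 'h \<Rightarrow> complex) \<Rightarrow> bool" where
  "hermitian_form sc D b \<longleftrightarrow> module.subspace sc D \<and>
     (\<forall>x\<in>D. \<forall>y\<in>D. \<forall>z\<in>D. b (x + y) z = b x z + b y z) \<and>
     (\<forall>a. \<forall>x\<in>D. \<forall>y\<in>D. b (sc a x) y = a * b x y) \<and>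
     (\<forall>x\<in>D. \<forall>y\<in>D. b y x = cnj (b x y))"

text \<open>Closed (semibounded) form in the sense of Kato VI.1.3.\<close>
definition closed_form ::
  "(complex \<Rightarrow> 'h::ab_group_add \<Rightarrow> 'h) \<Rightarrow> ('h \<Rightarrow> 'h \<Rightarrow> complex) \<Rightarrow> 'h set \<Rightarrow> ('h \<Rightarrow> 'h \<Rightarrow> complex) \<Rightarrow> bool" where
  "closed_form sc ip D b \<longleftrightarrow> hermitian_form sc D b \<and>
     (\<exists>c. \<forall>y\<in>D. Re (b y y) \<ge> c * (hnorm ip y)\<^sup>2) \<and>
     (\<forall>s u. (\<forall>n. s n \<in> D) \<and> hconv ip s u \<and>
        (\<forall>e>0. \<exists>N. \<forall>m\<ge>N. \<forall>n\<ge>N. \<bar>Re (b (s n - s m) (s n - s m))\<bar> < e) \<longrightarrow>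
        u \<in> D \<and> (\<lambda>n. Re (b (s n - u) (s n - u))) \<longlonglongrightarrow> 0)"

definition form_ext :: "'h set \<Rightarrow> ('h \<Rightarrow> 'h \<Rightarrow> complex) \<Rightarrow> 'h set \<Rightarrow> ('h \<Rightarrow> 'h \<Rightarrow> complex) \<Rightarrow> bool" where
  "form_ext D b D' b' \<longleftrightarrow> D \<subseteq> D' \<and> (\<forall>x\<in>D. \<forall>y\<in>D. b' x y = b x y)"

definition is_form_closure ::
  "(complex \<Rightarrow> 'h::ab_group_add \<Rightarrow> 'h) \<Rightarrow> ('h \<Rightarrow> 'h \<Rightarrow> complex) \<Rightarrow> 'h set \<Rightarrow> ('h \<Rightarrow> 'h \<Rightarrow> complex)
     \<Rightarrow> 'h set \<Rightarrow> ('h \<Rightarrow> 'h \<Rightarrow> complex) \<Rightarrow> bool" where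
  "is_form_closure sc ip D b Dc bc \<longleftrightarrow>
     closed_form sc ip Dc bc \<and> form_ext D b Dc bc \<and>
     (\<forall>D' b'. closed_form sc ip D' b' \<and> form_ext D b D' b' \<longrightarrow> form_ext Dc bc D' b')"

end

theory Submission
  imports Defs
begin

text \<open>
The eigenvalue curves can only cross zero downwards. Fix a point \<open>l0\<close> and write
\<open>\<Delta>\<close> for the difference quotient of the forms at \<open>l0\<close>. Split \<open>y = z + w\<close> with \<open>z\<close> in the kernel
of \<open>F(l0)\<close>. The hypothesis on eigenpairs makes \<open>\<Delta>[z]\<close> uniformly negative, and boundedness of the
derivative forms absorbs the cross terms: \<open>\<Delta>[z + w] \<le> - \<kappa> q[z] + C q[w]\<close>, where \<open>q\<close> is the square
of the form norm. On the negative spectral subspace and on the orthogonal complement of the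
nonpositive one the form at \<open>l0\<close> dominates \<open>q\<close> in absolute value. Hence just to the right of \<open>l0\<close> the
form is negative on the span of the nonpositive eigenvectors of \<open>F(l0)\<close>, and just to the left it is
positive on the complement of the negative ones. By the min-max principle \<open>\<nu>\<^sub>F\<close> jumps at \<open>l0\<close> exactly
by the kernel dimension, and the local statement is glued along the compact interval.

The coercivity estimate needs that all the form norms are equivalent. This comes from the uniform
boundedness principle, as the common form domain is complete in each of these norms.
\<close>

subsection \<open>Hermitian forms\<close>

text \<open>The kernel of \<open>F(l0)\<close> enters the form at \<open>l\<close> only at first
  order in \<open>l - l0\<close>, and so do the cross terms between the kernel and its complement;
  boundedness alone cannot decide which wins. The cross terms are therefore weighted: half of the
  negative amount available on \<open>z\<close> is spent on them, and the correspondingly large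
  constant falls on \<open>w\<close>. There it is harmless, because on \<open>w\<close> the form at
  \<open>l0\<close> has a gap of order one. Differentiability is given vector by vector, and the
  derivative is controlled only in one reference norm. The mean value theorem shows that each form
  is bounded by this norm. The argument also needs the converse, that the gap of
  \<open>F(l0)\<close>, measured in the ambient norm, controls the reference norm; this is where
  completeness enters. Of the spectral theory of each operator only the finitely many nonpositive
  eigenvalues and one gap above zero are used; a variational argument with the compact resolvent
  supplies them.\<close>

locale complex_hilbert_space =
  fixes sc :: "complex \<Rightarrow> 'h::ab_group_add \<Rightarrow> 'h"
    and ip :: "'h \<Rightarrow> 'h \<Rightarrow> complex"
  assumes hilbert: "complex_hilbert sc ip"
begin

sublocale vector_space sc
  using hilbert by (simp add: complex_hilbert_def)

context
  fixes V :: "'h set" and b :: "'h \<Rightarrow> 'h \<Rightarrow> complex"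
  assumes herm: "hermitian_form sc V b"
begin

lemma form_subspace: "subspace V"
  using herm unfolding hermitian_form_def by blast

lemma form_add_left: "x \<in> V \<Longrightarrow> y \<in> V \<Longrightarrow> z \<in> V \<Longrightarrow> b (x + y) z = b x z + b y z"
  using herm unfolding hermitian_form_def by blast

lemma form_scale_left: "x \<in> V \<Longrightarrow> y \<in> V \<Longrightarrow> b (sc t x) y = t * b x y"
  using herm unfolding hermitian_form_def by blast

lemma form_sym: "x \<in> V \<Longrightarrow> y \<in> V \<Longrightarrow> b y x = cnj (b x y)"
  using herm unfolding hermitian_form_def by blast

lemma form_add_right: "x \<in> V \<Longrightarrow> y \<in> V \<Longrightarrow> z \<in> V \<Longrightarrow> b x (y + z) = b x y + b x z"
  using form_sym[of "y + z" x] form_sym[of y x] form_sym[of z x]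
  by (simp add: subspace_add[OF form_subspace] form_add_left)

lemma form_scale_right: "x \<in> V \<Longrightarrow> y \<in> V \<Longrightarrow> b x (sc t y) = cnj t * b x y"
  using form_sym[of "sc t y" x] form_sym[of y x]
  by (simp add: subspace_scale[OF form_subspace] form_scale_left)

lemma form_minus_left: "x \<in> V \<Longrightarrow> y \<in> V \<Longrightarrow> b (- x) y = - b x y"
  using form_scale_left[of x y "-1"] by simp

lemma form_minus_right: "x \<in> V \<Longrightarrow> y \<in> V \<Longrightarrow> b x (- y) = - b x y"
  using form_scale_right[of x y "-1"] by simp

lemma form_diff_left: "x \<in> V \<Longrightarrow> y \<in> V \<Longrightarrow> z \<in> V \<Longrightarrow> b (x - y) z = b x z - b y z"
  using form_add_left[of x "-y" z]
  by (simp add: form_minus_left subspace_neg[OF form_subspace])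

lemma form_diff_right: "x \<in> V \<Longrightarrow> y \<in> V \<Longrightarrow> z \<in> V \<Longrightarrow> b x (y - z) = b x y - b x z"
  using form_add_right[of x y "-z"]
  by (simp add: form_minus_right subspace_neg[OF form_subspace])

lemma form_zero_left: "y \<in> V \<Longrightarrow> b 0 y = 0"
  using form_diff_left[of y y y] by simp

lemma form_zero_right: "y \<in> V \<Longrightarrow> b y 0 = 0"
  using form_diff_right[of y y y] by simp

lemma form_Im: "y \<in> V \<Longrightarrow> Im (b y y) = 0"
  using arg_cong[OF form_sym[of y y], of Im] by simp

lemma form_Re_sym: "x \<in> V \<Longrightarrow> y \<in> V \<Longrightarrow> Re (b y x) = Re (b x y)"
  using form_sym[of x y] by simp

lemma form_square_add:
  "x \<in> V \<Longrightarrow> y \<in> V \<Longrightarrow> Re (b (x + y) (x + y)) = Re (b x x) + 2 * Re (b x y) + Re (b y y)"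
  using form_Re_sym[of x y]
  by (simp add: form_add_left form_add_right subspace_add[OF form_subspace])

lemma form_square_diff:
  "x \<in> V \<Longrightarrow> y \<in> V \<Longrightarrow> Re (b (x - y) (x - y)) = Re (b x x) - 2 * Re (b x y) + Re (b y y)"
  using form_Re_sym[of x y]
  by (simp add: form_diff_left form_diff_right subspace_diff[OF form_subspace])

lemma form_square_scale: "x \<in> V \<Longrightarrow> Re (b (sc t x) (sc t x)) = (cmod t)\<^sup>2 * Re (b x x)"
proof -
  assume x: "x \<in> V"
  have "b (sc t x) (sc t x) = (t * cnj t) * b x x"
    using x by (simp add: form_scale_left form_scale_right subspace_scale[OF form_subspace] mult_ac)
  then show ?thesis
    by (simp flip: complex_norm_square)
qed

lemma form_square_minus_commute: "x \<in> V \<Longrightarrow> y \<in> V \<Longrightarrow> b (x - y) (x - y) = b (y - x) (y - x)"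
proof -
  assume x: "x \<in> V" and y: "y \<in> V"
  have d: "x - y \<in> V" using x y by (rule subspace_diff[OF form_subspace])
  have "b (- (x - y)) (- (x - y)) = b (x - y) (x - y)"
    using d by (simp only: form_minus_left form_minus_right subspace_neg[OF form_subspace] minus_minus)
  then show ?thesis by (simp only: minus_diff_eq)
qed

text \<open>Discriminant argument for \<open>b[x - t b(x,y) y]\<close> as a quadratic in real
  \<open>t\<close>; the factor \<open>b x y\<close> fixes the phase. Only semidefiniteness is
  assumed, since the lemma is later applied to a form minus its Rayleigh infimum, which may have
  null vectors.\<close>

lemma form_Cauchy_Schwarz:
  assumes nn: "\<And>y. y \<in> V \<Longrightarrow> 0 \<le> Re (b y y)" and x: "x \<in> V" and y: "y \<in> V"
  shows "(cmod (b x y))\<^sup>2 \<le> Re (b x x) * Re (b y y)"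
proof (cases "b x y = 0")
  case True
  then show ?thesis using nn x y by simp
next
  case False
  define W where "W = (cmod (b x y))\<^sup>2"
  define X where "X = Re (b x x)"
  define Y where "Y = Re (b y y)"
  have W: "W > 0" using False by (simp add: W_def)
  have quad: "X - 2 * t * W + t\<^sup>2 * W * Y \<ge> 0" for t :: real
  proof -
    let ?z = "sc (of_real t * b x y) y"
    have z: "?z \<in> V" using y by (simp add: subspace_scale[OF form_subspace])
    have "Re (b x ?z) = t * W"
      using x y by (simp add: form_scale_right W_def cmod_power2) (simp add: power2_eq_square algebra_simps)
    moreover have "Re (b ?z ?z) = t\<^sup>2 * W * Y"
      using y by (simp add: form_square_scale W_def Y_def norm_mult power_mult_distrib)
    moreover have "0 \<le> Re (b (x - ?z) (x - ?z))"
      using x z by (intro nn subspace_diff[OF form_subspace])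
    ultimately show ?thesis
      using form_square_diff[OF x z] by (simp add: X_def)
  qed
  have "Y \<ge> 0" using nn y by (simp add: Y_def)
  have "Y \<noteq> 0"
  proof
    assume "Y = 0"
    \<comment> \<open>With \<open>Y = 0\<close> the expression is linear in \<open>t\<close>, and
      this \<open>t\<close> gives it the value \<open>-1\<close>.\<close>
    with quad[of "(X + 1) / (2 * W)"] W show False by simp
  qed
  with \<open>Y \<ge> 0\<close> have "Y > 0" by simp
  with quad[of "1 / Y"] have "X - W / Y \<ge> 0"
    by (simp add: power2_eq_square)
  then have "W \<le> X * Y" using \<open>Y > 0\<close> by (simp add: field_simps)
  then show ?thesis by (simp add: W_def X_def Y_def)
qed

lemma form_Cauchy_Schwarz_sqrt:
  assumes nn: "\<And>y. y \<in> V \<Longrightarrow> 0 \<le> Re (b y y)" and x: "x \<in> V" and y: "y \<in> V"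
  shows "cmod (b x y) \<le> sqrt (Re (b x x)) * sqrt (Re (b y y))"
  using real_sqrt_le_mono[OF form_Cauchy_Schwarz[OF nn x y]] by (simp add: real_sqrt_mult)

lemma form_triangle:
  assumes nn: "\<And>y. y \<in> V \<Longrightarrow> 0 \<le> Re (b y y)" and x: "x \<in> V" and y: "y \<in> V"
  shows "sqrt (Re (b (x + y) (x + y))) \<le> sqrt (Re (b x x)) + sqrt (Re (b y y))"
proof (rule real_le_lsqrt)
  have "Re (b x y) \<le> cmod (b x y)" by (rule complex_Re_le_cmod)
  also have "\<dots> \<le> sqrt (Re (b x x)) * sqrt (Re (b y y))"
    using form_Cauchy_Schwarz_sqrt[OF nn x y] .
  finally show "Re (b (x + y) (x + y)) \<le> (sqrt (Re (b x x)) + sqrt (Re (b y y)))\<^sup>2"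
    using nn x y by (simp add: form_square_add power2_sum)
qed (use nn x y in simp)

text \<open>Polarization, with \<open>x\<close> scaled by \<open>s\<close> and \<open>y\<close> by \<open>1/s\<close> to weight the two terms.\<close>
lemma form_cross_bound:
  assumes q: "hermitian_form sc V q"
    and bd: "\<And>y. y \<in> V \<Longrightarrow> \<bar>Re (b y y)\<bar> \<le> C * Re (q y y)"
    and x: "x \<in> V" and y: "y \<in> V" and s: "s > 0"
  shows "\<bar>2 * Re (b x y)\<bar> \<le> C * (s\<^sup>2 * Re (q x x) + Re (q y y) / s\<^sup>2)"
proof -
  let ?x = "sc (of_real s) x" and ?y = "sc (of_real (1 / s)) y"
  have V: "?x \<in> V" "?y \<in> V"
    using x y by (simp_all add: subspace_scale[OF form_subspace])
  have bxy: "b ?x ?y = b x y"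
    using V x y s by (simp add: form_scale_left form_scale_right)
  have qx: "Re (q ?x ?x) = s\<^sup>2 * Re (q x x)" and qy: "Re (q ?y ?y) = Re (q y y) / s\<^sup>2"
    using x y s complex_hilbert_space.form_square_scale[OF complex_hilbert_space_axioms q]
    by (simp_all add: power_divide norm_divide)
  have par: "Re (q (?x + ?y) (?x + ?y)) + Re (q (?x - ?y) (?x - ?y)) = 2 * (Re (q ?x ?x) + Re (q ?y ?y))"
    using complex_hilbert_space.form_square_add[OF complex_hilbert_space_axioms q V]
      complex_hilbert_space.form_square_diff[OF complex_hilbert_space_axioms q V] by simp
  have "4 * Re (b ?x ?y) = Re (b (?x + ?y) (?x + ?y)) - Re (b (?x - ?y) (?x - ?y))"
    using form_square_add[OF V] form_square_diff[OF V] by simp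
  moreover have "\<bar>Re (b (?x + ?y) (?x + ?y))\<bar> \<le> C * Re (q (?x + ?y) (?x + ?y))"
    "\<bar>Re (b (?x - ?y) (?x - ?y))\<bar> \<le> C * Re (q (?x - ?y) (?x - ?y))"
    using V by (auto intro!: bd subspace_add[OF form_subspace] subspace_diff[OF form_subspace])
  moreover have "C * Re (q (?x + ?y) (?x + ?y)) + C * Re (q (?x - ?y) (?x - ?y))
      = 2 * (C * (Re (q ?x ?x) + Re (q ?y ?y)))"
    using arg_cong[OF par, of "\<lambda>t. C * t"] by (simp only: distrib_left mult.left_commute)
  ultimately have "\<bar>2 * Re (b ?x ?y)\<bar> \<le> C * (Re (q ?x ?x) + Re (q ?y ?y))"
    by linarith
  then show ?thesis by (simp only: bxy qx qy)
qed

end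

end

subsection \<open>Orthonormal systems\<close>

context complex_hilbert_space
begin

lemma ip_form: "hermitian_form sc UNIV ip"
proof -
  have add: "\<forall>x y z. ip (x + y) z = ip x z + ip y z"
    using hilbert unfolding complex_hilbert_def by (elim conjE)
  have scale: "\<forall>a x y. ip (sc a x) y = a * ip x y"
    using hilbert unfolding complex_hilbert_def by (elim conjE)
  have sym: "\<forall>x y. ip y x = cnj (ip x y)"
    using hilbert unfolding complex_hilbert_def by (elim conjE)
  show ?thesis
    unfolding hermitian_form_def
    by (intro conjI ballI allI subspace_UNIV add[rule_format] scale[rule_format] sym[rule_format])
qed

lemmas ip_add_left = form_add_left[OF ip_form UNIV_I UNIV_I UNIV_I]
  and ip_diff_left = form_diff_left[OF ip_form UNIV_I UNIV_I UNIV_I]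
  and ip_add_right = form_add_right[OF ip_form UNIV_I UNIV_I UNIV_I]
  and ip_diff_right = form_diff_right[OF ip_form UNIV_I UNIV_I UNIV_I]
  and ip_scale_left = form_scale_left[OF ip_form UNIV_I UNIV_I]
  and ip_scale_right = form_scale_right[OF ip_form UNIV_I UNIV_I]
  and ip_zero_left [simp] = form_zero_left[OF ip_form UNIV_I]
  and ip_zero_right [simp] = form_zero_right[OF ip_form UNIV_I]
  and ip_Im [simp] = form_Im[OF ip_form UNIV_I]
  and ip_sym = form_sym[OF ip_form UNIV_I UNIV_I]

lemma ip_pos: "x \<noteq> 0 \<Longrightarrow> Re (ip x x) > 0"
proof -
  have "\<forall>x. x \<noteq> 0 \<longrightarrow> Re (ip x x) > 0"
    using hilbert unfolding complex_hilbert_def by (elim conjE)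
  then show "x \<noteq> 0 \<Longrightarrow> Re (ip x x) > 0" by blast
qed

lemma ip_nonneg: "Re (ip x x) \<ge> 0"
  using ip_pos[of x] by (cases "x = 0") auto

section \<open>Norm, convergence and limits of inner products\<close>

abbreviation nrm :: "'h \<Rightarrow> real" where "nrm \<equiv> hnorm ip"

lemma nrm_sq: "(nrm x)\<^sup>2 = Re (ip x x)"
  by (simp add: hnorm_def ip_nonneg)

lemma ip_self: "ip x x = of_real ((nrm x)\<^sup>2)"
  by (simp add: complex_eq_iff nrm_sq)

lemma nrm_nonneg [simp]: "nrm x \<ge> 0"
  by (simp add: hnorm_def ip_nonneg)

lemma nrm_eq_0 [simp]: "nrm x = 0 \<longleftrightarrow> x = 0"
  using ip_pos[of x] by (cases "x = 0") (auto simp: hnorm_def)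

lemma nrm_zero [simp]: "nrm 0 = 0"
  by simp

lemma nrm_pos: "x \<noteq> 0 \<Longrightarrow> nrm x > 0"
  using nrm_nonneg[of x] nrm_eq_0[of x] by linarith

lemma nrm_scale: "nrm (sc t x) = cmod t * nrm x"
  by (simp add: hnorm_def form_square_scale[OF ip_form] real_sqrt_mult)

lemma nrm_triangle: "nrm (x + y) \<le> nrm x + nrm y"
  unfolding hnorm_def by (rule form_triangle[OF ip_form]) (auto simp: ip_nonneg)

lemma nrm_minus_commute: "nrm (x - y) = nrm (y - x)"
  using form_square_minus_commute[OF ip_form UNIV_I UNIV_I, of x y] by (simp add: hnorm_def)

lemma nrm_triangle_diff: "nrm (x - z) \<le> nrm (x - y) + nrm (y - z)"
  using nrm_triangle[of "x - y" "y - z"] by simp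

lemma nrm_diff_bound: "\<bar>nrm x - nrm y\<bar> \<le> nrm (x - y)"
  using nrm_triangle[of "x - y" y] nrm_triangle[of "y - x" x] nrm_minus_commute[of x y] by simp

lemma ip_Cauchy_Schwarz: "cmod (ip x y) \<le> nrm x * nrm y"
  unfolding hnorm_def
  by (rule form_Cauchy_Schwarz_sqrt[OF ip_form]) (auto simp: ip_nonneg)

lemma nrm_sq_diff: "(nrm (x - y))\<^sup>2 = (nrm x)\<^sup>2 - 2 * Re (ip x y) + (nrm y)\<^sup>2"
  by (simp add: nrm_sq form_square_diff[OF ip_form])

lemma nrm_complete:
  assumes "\<And>e. e > 0 \<Longrightarrow> \<exists>N. \<forall>m\<ge>N. \<forall>n\<ge>N. nrm (s m - s n) < e"
  shows "\<exists>l. hconv ip s l"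
proof -
  have "\<forall>s. (\<forall>e>0. \<exists>N. \<forall>m\<ge>N. \<forall>n\<ge>N. nrm (s m - s n) < e) \<longrightarrow> (\<exists>l. hconv ip s l)"
    using hilbert unfolding complex_hilbert_def by (elim conjE)
  then show ?thesis using assms by simp
qed

lemma hconvD: "hconv ip s l \<Longrightarrow> (\<lambda>n. nrm (s n - l)) \<longlonglongrightarrow> 0"
  by (simp add: hconv_def)

lemma hconv_nrm: "hconv ip s l \<Longrightarrow> (\<lambda>n. nrm (s n)) \<longlonglongrightarrow> nrm l"
proof -
  assume "hconv ip s l"
  then have "(\<lambda>n. nrm (s n - l)) \<longlonglongrightarrow> 0" by (rule hconvD)
  then have "(\<lambda>n. nrm (s n) - nrm l) \<longlonglongrightarrow> 0"
    by (rule Lim_null_comparison[rotated]) (auto simp: nrm_diff_bound)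
  then show ?thesis by (rule LIM_zero_cancel)
qed

lemma hconv_ip_left: "hconv ip s l \<Longrightarrow> (\<lambda>n. ip (s n) y) \<longlonglongrightarrow> ip l y"
proof -
  assume "hconv ip s l"
  then have "(\<lambda>n. nrm (s n - l) * nrm y) \<longlonglongrightarrow> 0 * nrm y"
    by (intro tendsto_mult tendsto_const hconvD)
  then have "(\<lambda>n. nrm (s n - l) * nrm y) \<longlonglongrightarrow> 0" by simp
  then have "(\<lambda>n. ip (s n) y - ip l y) \<longlonglongrightarrow> 0"
    by (rule Lim_null_comparison[rotated])
      (auto simp: ip_Cauchy_Schwarz simp flip: ip_diff_left)
  then show ?thesis by (rule LIM_zero_cancel)
qed

lemma hconv_ip_right: "hconv ip s l \<Longrightarrow> (\<lambda>n. ip y (s n)) \<longlonglongrightarrow> ip y l"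
  using tendsto_cnj[OF hconv_ip_left[of s l y]] by (simp flip: ip_sym)

lemma hconv_diff_small:
  assumes "hconv ip s l" and "(\<lambda>n. nrm (t n - s n)) \<longlonglongrightarrow> 0"
  shows "hconv ip t l"
proof -
  have "(\<lambda>n. nrm (t n - s n) + nrm (s n - l)) \<longlonglongrightarrow> 0 + 0"
    using assms by (intro tendsto_add hconvD)
  then have "(\<lambda>n. nrm (t n - s n) + nrm (s n - l)) \<longlonglongrightarrow> 0" by simp
  then show ?thesis unfolding hconv_def
    by (rule Lim_null_comparison[rotated]) (simp add: nrm_triangle_diff)
qed

lemma hconv_scale: "hconv ip s l \<Longrightarrow> hconv ip (\<lambda>n. sc t (s n)) (sc t l)"
  using tendsto_mult_right_zero[of "\<lambda>n. nrm (s n - l)" sequentially "cmod t"]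
  by (simp add: hconv_def nrm_scale flip: scale_right_diff_distrib)

lemma ip_sum_left: "ip (\<Sum>e\<in>B. g e) y = (\<Sum>e\<in>B. ip (g e) y)"
  by (induction B rule: infinite_finite_induct) (auto simp: ip_add_left)

lemma ip_sum_right: "ip y (\<Sum>e\<in>B. g e) = (\<Sum>e\<in>B. ip y (g e))"
  by (induction B rule: infinite_finite_induct) (auto simp: ip_add_right)

definition orthonormal :: "'h set \<Rightarrow> bool" where
  "orthonormal B \<longleftrightarrow> (\<forall>x\<in>B. \<forall>y\<in>B. ip x y = (if x = y then 1 else 0))"

lemma orthonormal_subset: "orthonormal B \<Longrightarrow> A \<subseteq> B \<Longrightarrow> orthonormal A"
  unfolding orthonormal_def by blast

lemma orthonormal_ip_sum:
  assumes "orthonormal B" "finite B" "e \<in> B"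
  shows "ip (\<Sum>x\<in>B. sc (c x) x) e = c e"
proof -
  have "ip (\<Sum>x\<in>B. sc (c x) x) e = (\<Sum>x\<in>B. if x = e then c e else 0)"
    unfolding ip_sum_left
    by (rule sum.cong) (use assms in \<open>auto simp: ip_scale_left orthonormal_def\<close>)
  then show ?thesis using assms by simp
qed

lemma orthonormal_independent:
  assumes "orthonormal B" shows "independent B"
  unfolding dependent_explicit
proof safe
  fix t u v assume t: "finite t" "t \<subseteq> B" "(\<Sum>v\<in>t. sc (u v) v) = 0" "v \<in> t" "u v \<noteq> 0"
  have "u v = ip (\<Sum>v\<in>t. sc (u v) v) v"
    using t orthonormal_ip_sum[OF orthonormal_subset[OF assms t(2)], of v u] by simp
  with t show False by simp
qed

definition proj :: "'h set \<Rightarrow> 'h \<Rightarrow> 'h" where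
  "proj B x = (\<Sum>e\<in>B. sc (ip x e) e)"

lemma proj_in_span: "proj B x \<in> span B"
  unfolding proj_def by (intro span_sum span_scale span_base)

lemma ip_proj: "orthonormal B \<Longrightarrow> finite B \<Longrightarrow> e \<in> B \<Longrightarrow> ip (proj B x) e = ip x e"
  unfolding proj_def by (rule orthonormal_ip_sum)

lemma proj_span:
  assumes "orthonormal B" "finite B" "x \<in> span B" shows "proj B x = x"
proof -
  obtain c where "x = (\<Sum>e\<in>B. sc (c e) e)"
    using assms(3) unfolding span_finite[OF assms(2)] by blast
  then show ?thesis unfolding proj_def
    by (simp add: orthonormal_ip_sum assms cong: sum.cong)
qed

lemma ip_span_orthogonal:
  assumes "\<And>e. e \<in> B \<Longrightarrow> ip x e = 0" "y \<in> span B" shows "ip x y = 0"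
  using assms(2)
  by (induction rule: span_induct_alt) (auto simp: ip_add_right ip_scale_right assms(1))

lemma parseval_span:
  assumes "orthonormal B" "finite B" "x \<in> span B"
  shows "(nrm x)\<^sup>2 = (\<Sum>e\<in>B. (cmod (ip x e))\<^sup>2)"
proof -
  have "ip x x = ip x (proj B x)" using proj_span[OF assms] by simp
  also have "\<dots> = (\<Sum>e\<in>B. of_real ((cmod (ip x e))\<^sup>2))"
    unfolding proj_def ip_sum_right
    by (rule sum.cong) (simp_all only: ip_scale_right complex_norm_square mult.commute)
  finally show ?thesis by (simp add: nrm_sq)
qed

text \<open>The dimension count behind both min-max bounds: without such a vector
  \<open>proj B\<close> would be injective on \<open>span C\<close> and carry the independent set
  \<open>C\<close> into a space spanned by only \<open>card B\<close> vectors.\<close>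

lemma exists_orthogonal_in_span:
  assumes B: "orthonormal B" "finite B" and C: "independent C" and card: "card B < card C"
  shows "\<exists>y\<in>span C. y \<noteq> 0 \<and> (\<forall>e\<in>B. ip y e = 0)"
proof (rule ccontr)
  assume neg: "\<not> ?thesis"
  have lin: "Vector_Spaces.linear sc sc (proj B)"
    by (simp add: Vector_Spaces.linear_iff vector_space_axioms proj_def ip_add_left ip_scale_left
        scale_left_distrib sum.distrib scale_sum_right)
  then have hom: "module_hom sc sc (proj B)"
    by (simp add: module_hom_iff_linear)
  have inj: "inj_on (proj B) (span C)"
  proof (rule inj_onI)
    fix x y assume xy: "x \<in> span C" "y \<in> span C" "proj B x = proj B y"
    have "ip (x - y) e = 0" if "e \<in> B" for e
      using arg_cong[OF xy(3), of "\<lambda>z. ip z e"] that ip_proj[OF B] by (simp add: ip_diff_left)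
    then show "x = y"
      using neg span_diff[OF xy(1,2)] by force
  qed
  have "independent (proj B ` C)"
    using module_hom.independent_injective_image[OF hom C inj] .
  then have "card (proj B ` C) \<le> card B"
    using independent_span_bound[OF B(2)] proj_in_span by blast
  moreover have "card (proj B ` C) = card C"
    by (rule card_image) (rule inj_on_subset[OF inj], rule span_superset)
  ultimately show False using card by simp
qed

text \<open>Parallelogram law with the nonnegative term for \<open>x - y\<close> dropped; it keeps
  approximation estimates free of square roots.\<close>

lemma form_add_le:
  assumes "hermitian_form sc V b" and "\<And>y. y \<in> V \<Longrightarrow> 0 \<le> Re (b y y)" and "x \<in> V" "y \<in> V"
  shows "Re (b (x + y) (x + y)) \<le> 2 * Re (b x x) + 2 * Re (b y y)"
  using assms(2)[OF subspace_diff[OF form_subspace[OF assms(1)] assms(3,4)]]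
    form_square_add[OF assms(1,3,4)] form_square_diff[OF assms(1,3,4)] by linarith

lemma hermitian_form_subspace:
  assumes "hermitian_form sc V b" "subspace U" "U \<subseteq> V"
  shows "hermitian_form sc U b"
  unfolding hermitian_form_def
  using assms by (intro conjI ballI allI) (blast intro: form_add_left form_scale_left form_sym)+

lemma hermitian_form_add_ip:
  assumes "hermitian_form sc V b"
  shows "hermitian_form sc V (\<lambda>x y. b x y + of_real r * ip x y)"
  unfolding hermitian_form_def
proof (intro conjI ballI allI)
  fix x y assume "x \<in> V" "y \<in> V"
  then show "b y x + of_real r * ip y x = cnj (b x y + of_real r * ip x y)"
    unfolding complex_cnj_add complex_cnj_mult complex_cnj_complex_of_real
    using form_sym[OF assms] ip_sym by metis
qed (use assms in \<open>auto simp: form_subspace form_add_left form_scale_left ip_add_left ip_scale_left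
      algebra_simps\<close>)

end

subsection \<open>Self-adjoint operators and their forms\<close>

locale self_adjoint_with_form = complex_hilbert_space sc ip
  for sc :: "complex \<Rightarrow> 'h::ab_group_add \<Rightarrow> 'h" and ip :: "'h \<Rightarrow> 'h \<Rightarrow> complex" +
  fixes D :: "'h set" and A :: "'h \<Rightarrow> 'h" and V :: "'h set" and a :: "'h \<Rightarrow> 'h \<Rightarrow> complex"
  assumes self_adjoint: "self_adjoint_op sc ip D A"
    and compact_res: "compact_resolvent sc ip D A"
    and form_closure: "is_form_closure sc ip D (\<lambda>x y. ip (A x) y) V a"
begin

lemma D_subspace: "subspace D"
  using self_adjoint unfolding self_adjoint_op_def lin_op_def by blast

lemma A_add: "x \<in> D \<Longrightarrow> y \<in> D \<Longrightarrow> A (x + y) = A x + A y"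
  using self_adjoint unfolding self_adjoint_op_def lin_op_def by blast

lemma A_scale: "x \<in> D \<Longrightarrow> A (sc t x) = sc t (A x)"
  using self_adjoint unfolding self_adjoint_op_def lin_op_def by blast

lemma A_diff: "x \<in> D \<Longrightarrow> y \<in> D \<Longrightarrow> A (x - y) = A x - A y"
  using A_add[of x "- y"] A_scale[of y "-1"] by (simp add: subspace_neg[OF D_subspace])

lemma A_zero: "A 0 = 0"
  using A_diff[of 0 0] subspace_0[OF D_subspace] by simp

lemma A_symmetric: "x \<in> D \<Longrightarrow> y \<in> D \<Longrightarrow> ip (A x) y = ip x (A y)"
  using self_adjoint unfolding self_adjoint_op_def by blast

lemma D_dense: "e > 0 \<Longrightarrow> \<exists>y\<in>D. nrm (x - y) < e"
  using self_adjoint unfolding self_adjoint_op_def dense_in_def by blast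

lemma orthogonal_to_D:
  assumes "\<And>x. x \<in> D \<Longrightarrow> ip x z = 0" shows "z = 0"
proof (rule ccontr)
  assume "z \<noteq> 0"
  then have z: "nrm z > 0" by (rule nrm_pos)
  then obtain x where x: "x \<in> D" "nrm (z - x) < nrm z" using D_dense by blast
  have "(nrm z)\<^sup>2 = Re (ip (z - x) z)"
    using assms[OF x(1)] by (simp add: nrm_sq ip_diff_left)
  also have "\<dots> \<le> nrm (z - x) * nrm z"
    using ip_Cauchy_Schwarz complex_Re_le_cmod order_trans by blast
  also have "\<dots> < nrm z * nrm z" using x(2) z by (rule mult_strict_right_mono)
  finally show False by (simp add: power2_eq_square)
qed

text \<open>Symmetry passes to the limit, so \<open>l\<close> lies in the adjoint domain, which is
  \<open>D\<close> by self-adjointness; density of \<open>D\<close> then identifies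
  \<open>A l\<close>.\<close>

lemma A_closed:
  assumes "\<And>n. g n \<in> D" "hconv ip g l" "hconv ip (\<lambda>n. A (g n)) w"
  shows "l \<in> D \<and> A l = w"
proof -
  have eq: "ip (A x) l = ip x w" if x: "x \<in> D" for x
  proof (rule LIMSEQ_unique)
    show "(\<lambda>n. ip (A x) (g n)) \<longlonglongrightarrow> ip (A x) l" by (rule hconv_ip_right[OF assms(2)])
    show "(\<lambda>n. ip (A x) (g n)) \<longlonglongrightarrow> ip x w"
      using hconv_ip_right[OF assms(3), of x] A_symmetric[OF x assms(1)] by simp
  qed
  then have "l \<in> adjoint_domain ip D A" unfolding adjoint_domain_def by blast
  then have l: "l \<in> D" using self_adjoint unfolding self_adjoint_op_def by blast
  have "A l - w = 0"
    by (rule orthogonal_to_D) (use eq A_symmetric l in \<open>simp add: ip_diff_right\<close>)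
  with l show ?thesis by simp
qed

abbreviation R :: "'h \<Rightarrow> 'h" where "R \<equiv> resolvent_i sc D A"

lemma R_ex1: "\<exists>!x. x \<in> D \<and> A x - sc \<i> x = y"
  using compact_res unfolding compact_resolvent_def by blast

lemma R_in_D: "R y \<in> D" and A_R: "A (R y) = y + sc \<i> (R y)"
proof -
  have "R y \<in> D \<and> A (R y) - sc \<i> (R y) = y"
    unfolding resolvent_i_def by (rule theI'[OF R_ex1])
  then show "R y \<in> D" "A (R y) = y + sc \<i> (R y)" by (auto simp: diff_eq_eq)
qed

lemma R_inverse: "x \<in> D \<Longrightarrow> R (A x - sc \<i> x) = x"
  unfolding resolvent_i_def using R_ex1 by (intro the1_equality) auto

lemma R_compact:
  assumes "\<And>n::nat. nrm (s n) \<le> M"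
  shows "\<exists>r l. strict_mono r \<and> hconv ip (\<lambda>n. R (s (r n))) l"
proof -
  have *: "\<forall>s M. (\<forall>n::nat. nrm (s n) \<le> M) \<longrightarrow> (\<exists>r l. strict_mono r \<and> hconv ip (\<lambda>n. R (s (r n))) l)"
    using compact_res unfolding compact_resolvent_def by (elim conjE)
  show ?thesis by (rule *[rule_format, OF assms])
qed

section \<open>The closed form, its norm and its core\<close>

lemma a_closed: "closed_form sc ip V a"
  using form_closure unfolding is_form_closure_def by blast

lemma a_form: "hermitian_form sc V a"
  using a_closed unfolding closed_form_def by (elim conjE)

lemma V_subspace: "subspace V"
  by (rule form_subspace[OF a_form])

lemma D_subset_V: "D \<subseteq> V"
  using form_closure unfolding is_form_closure_def form_ext_def by (elim conjE)

lemma a_on_D: "x \<in> D \<Longrightarrow> y \<in> D \<Longrightarrow> a x y = ip (A x) y"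
proof -
  have "\<forall>x\<in>D. \<forall>y\<in>D. a x y = ip (A x) y"
    using form_closure unfolding is_form_closure_def form_ext_def by (elim conjE)
  then show "x \<in> D \<Longrightarrow> y \<in> D \<Longrightarrow> a x y = ip (A x) y" by blast
qed

lemma closure_minimal: "closed_form sc ip D' b \<Longrightarrow> form_ext D (\<lambda>x y. ip (A x) y) D' b \<Longrightarrow> V \<subseteq> D'"
  using form_closure unfolding is_form_closure_def form_ext_def by blast

lemma ex_lower_bound: "\<exists>c. \<forall>y\<in>V. Re (a y y) \<ge> c * (nrm y)\<^sup>2"
  using a_closed unfolding closed_form_def by (elim conjE)

definition lb :: real where "lb = (SOME c. \<forall>y\<in>V. Re (a y y) \<ge> c * (nrm y)\<^sup>2)"

lemma lb: "y \<in> V \<Longrightarrow> Re (a y y) \<ge> lb * (nrm y)\<^sup>2"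
  using someI_ex[OF ex_lower_bound] unfolding lb_def by blast

text \<open>The shift gives \<open>p[y] \<ge> |y|^2\<close>, so \<open>sqrt (Re (p y y))\<close> is
  Kato's form norm and dominates the ambient one. The number \<open>lb\<close> in it is some lower
  bound of the form, not necessarily the best.\<close>

definition p :: "'h \<Rightarrow> 'h \<Rightarrow> complex" where "p x y = a x y + of_real (1 - lb) * ip x y"

lemma p_form: "hermitian_form sc V p"
  unfolding p_def by (rule hermitian_form_add_ip[OF a_form])

lemma Re_p: "Re (p y y) = Re (a y y) + (1 - lb) * (nrm y)\<^sup>2"
  by (simp add: p_def ip_self)

lemma p_ge: "y \<in> V \<Longrightarrow> Re (p y y) \<ge> (nrm y)\<^sup>2"
  using lb[of y] by (simp add: Re_p algebra_simps)

lemma p_nonneg: "y \<in> V \<Longrightarrow> 0 \<le> Re (p y y)"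
  by (rule order_trans[OF _ p_ge]) auto

lemma nrm_le_p: "y \<in> V \<Longrightarrow> nrm y \<le> sqrt (Re (p y y))"
  by (rule real_le_rsqrt) (rule p_ge)

lemma a_closedD:
  assumes "\<And>n. s n \<in> V" "hconv ip s u"
    "\<And>e. e > 0 \<Longrightarrow> \<exists>N. \<forall>m\<ge>N. \<forall>n\<ge>N. \<bar>Re (a (s n - s m) (s n - s m))\<bar> < e"
  shows "u \<in> V" "(\<lambda>n. Re (p (s n - u) (s n - u))) \<longlonglongrightarrow> 0"
proof -
  have "\<forall>s u. (\<forall>n. s n \<in> V) \<and> hconv ip s u \<and>
        (\<forall>e>0. \<exists>N. \<forall>m\<ge>N. \<forall>n\<ge>N. \<bar>Re (a (s n - s m) (s n - s m))\<bar> < e) \<longrightarrow>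
        u \<in> V \<and> (\<lambda>n. Re (a (s n - u) (s n - u))) \<longlonglongrightarrow> 0"
    using a_closed unfolding closed_form_def by (elim conjE)
  note this[THEN spec, of s, THEN spec, of u]
  then have *: "u \<in> V \<and> (\<lambda>n. Re (a (s n - u) (s n - u))) \<longlonglongrightarrow> 0"
    by (rule mp) (use assms in simp)
  then show "u \<in> V" by blast
  have "(\<lambda>n. Re (a (s n - u) (s n - u)) + (1 - lb) * (nrm (s n - u))\<^sup>2) \<longlonglongrightarrow> 0 + (1 - lb) * 0\<^sup>2"
    using * hconvD[OF assms(2)] by (intro tendsto_intros) auto
  then show "(\<lambda>n. Re (p (s n - u) (s n - u))) \<longlonglongrightarrow> 0" by (simp add: Re_p)
qed

text \<open>Kato's closedness is completeness of \<open>V\<close> in the form norm. A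
  \<open>p\<close>-Cauchy sequence is Cauchy in the ambient space, as \<open>p\<close> dominates its
  norm, and Cauchy for \<open>a\<close>, as \<open>a\<close> is bounded by a multiple of
  \<open>p\<close>.\<close>

lemma p_complete:
  assumes V: "\<And>n. s n \<in> V"
    and cau: "\<And>e. e > 0 \<Longrightarrow> \<exists>N. \<forall>m\<ge>N. \<forall>n\<ge>N. Re (p (s n - s m) (s n - s m)) < e"
  shows "\<exists>u\<in>V. (\<lambda>n. Re (p (s n - u) (s n - u))) \<longlonglongrightarrow> 0"
proof -
  have sV: "s n - s m \<in> V" for n m using V by (simp add: subspace_diff[OF V_subspace])
  have "\<exists>u. hconv ip s u"
  proof (rule nrm_complete)
    fix e :: real assume e: "e > 0"
    then obtain N where N: "\<forall>m\<ge>N. \<forall>n\<ge>N. Re (p (s n - s m) (s n - s m)) < e\<^sup>2"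
      using cau[of "e\<^sup>2"] by auto
    have "nrm (s m - s n) < e" if "m \<ge> N" "n \<ge> N" for m n
    proof -
      have "(nrm (s m - s n))\<^sup>2 < e\<^sup>2" using N that p_ge[OF sV] order_le_less_trans by blast
      then show ?thesis using e by (simp add: power_less_imp_less_base)
    qed
    then show "\<exists>N. \<forall>m\<ge>N. \<forall>n\<ge>N. nrm (s m - s n) < e" by blast
  qed
  then obtain u where u: "hconv ip s u" by blast
  have "\<exists>N. \<forall>m\<ge>N. \<forall>n\<ge>N. \<bar>Re (a (s n - s m) (s n - s m))\<bar> < e" if e: "e > 0" for e
  proof -
    \<comment> \<open>\<open>a\<close> is \<open>p\<close> minus \<open>1 - lb\<close> times the
      squared norm, and the squared norm is at most \<open>p\<close>.\<close>
    define K where "K = 1 + \<bar>1 - lb\<bar>"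
    have K: "K > 0" by (simp add: K_def)
    obtain N where N: "\<forall>m\<ge>N. \<forall>n\<ge>N. Re (p (s n - s m) (s n - s m)) < e / K"
      using cau[of "e / K"] e K by auto
    have "\<bar>Re (a y y)\<bar> \<le> K * Re (p y y)" if "y \<in> V" for y
    proof -
      have "\<bar>(1 - lb) * (nrm y)\<^sup>2\<bar> \<le> \<bar>1 - lb\<bar> * Re (p y y)"
        using p_ge[OF that] by (simp add: abs_mult mult_left_mono)
      then show ?thesis using Re_p[of y] p_nonneg[OF that] by (simp add: K_def distrib_right)
    qed
    then have "\<bar>Re (a (s n - s m) (s n - s m))\<bar> < e" if "n \<ge> N" "m \<ge> N" for n m
      using N[rule_format, OF that(2,1)] sV[of n m] K
      by (smt (verit) mult.commute pos_less_divide_eq)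
    then show ?thesis by blast
  qed
  from a_closedD[OF V u this] show ?thesis by blast
qed

text \<open>Minimality of the closure: the p-closure of the operator domain in V is already closed.\<close>
lemma D_core:
  assumes "u \<in> V" "e > 0"
  shows "\<exists>x\<in>D. Re (p (x - u) (x - u)) < e"
proof -
  define D' where "D' = {u \<in> V. \<forall>e>0. \<exists>x\<in>D. Re (p (x - u) (x - u)) < e}"
  have DV: "x \<in> V" if "x \<in> D" for x using that D_subset_V by blast
  have sV: "x - y \<in> V" if "x \<in> V" "y \<in> V" for x y using that by (simp add: subspace_diff[OF V_subspace])
  have chain: "Re (p (x - u) (x - u)) \<le> 2 * Re (p (x - v) (x - v)) + 2 * Re (p (v - u) (v - u))"
    if "x \<in> V" "v \<in> V" "u \<in> V" for x u v
    using form_add_le[OF p_form p_nonneg sV[OF that(1,2)] sV[OF that(2,3)]] by simp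
  have "D \<subseteq> D'"
    unfolding D'_def using DV form_zero_left[OF p_form]
    by (auto simp: subspace_0[OF V_subspace] intro!: bexI)
  have "subspace D'"
    unfolding subspace_def
  proof (intro conjI ballI allI)
    show "0 \<in> D'" using \<open>D \<subseteq> D'\<close> subspace_0[OF D_subspace] by blast
  next
    fix u v assume u: "u \<in> D'" and v: "v \<in> D'"
    have V: "u \<in> V" "v \<in> V" using u v by (auto simp: D'_def)
    have "\<exists>x\<in>D. Re (p (x - (u + v)) (x - (u + v))) < e" if e: "e > 0" for e
    proof -
      \<comment> \<open>\<open>form_add_le\<close> doubles each of the two errors, hence the
        quarters.\<close>
      obtain x y where x: "x \<in> D" "Re (p (x - u) (x - u)) < e / 4"
        and y: "y \<in> D" "Re (p (y - v) (y - v)) < e / 4"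
        using u v e unfolding D'_def by (smt (verit) divide_pos_pos mem_Collect_eq)
      have "Re (p ((x - u) + (y - v)) ((x - u) + (y - v))) < e"
        using form_add_le[OF p_form p_nonneg, of "x - u" "y - v"] x y V DV sV by force
      moreover have "(x - u) + (y - v) = (x + y) - (u + v)" by simp
      ultimately show ?thesis
        using subspace_add[OF D_subspace x(1) y(1)] by (intro bexI[of _ "x + y"]) simp_all
    qed
    then show "u + v \<in> D'" using subspace_add[OF V_subspace V] by (simp add: D'_def)
  next
    fix t u assume u: "u \<in> D'"
    have V: "u \<in> V" using u by (auto simp: D'_def)
    have "\<exists>x\<in>D. Re (p (x - sc t u) (x - sc t u)) < e" if e: "e > 0" for e
    proof -
      define T where "T = (cmod t)\<^sup>2"
      have T: "T \<ge> 0" by (simp add: T_def)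
      obtain x where x: "x \<in> D" "Re (p (x - u) (x - u)) < e / (T + 1)"
        using u e T unfolding D'_def by (smt (verit) divide_pos_pos mem_Collect_eq)
      have "Re (p (sc t (x - u)) (sc t (x - u))) = T * Re (p (x - u) (x - u))"
        unfolding T_def by (rule form_square_scale[OF p_form sV[OF DV[OF x(1)] V]])
      also have "\<dots> \<le> T * (e / (T + 1))" using T x(2) by (intro mult_left_mono) auto
      also have "\<dots> < e" using T e by (simp add: field_simps)
      finally have "Re (p (sc t (x - u)) (sc t (x - u))) < e" .
      then show ?thesis
        using subspace_scale[OF D_subspace x(1), of t]
        by (intro bexI[of _ "sc t x"]) (simp_all add: scale_right_diff_distrib)
    qed
    then show "sc t u \<in> D'" using subspace_scale[OF V_subspace V] by (simp add: D'_def)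
  qed
  have "closed_form sc ip D' a"
    unfolding closed_form_def
  proof (intro conjI allI impI)
    show "hermitian_form sc D' a"
      using hermitian_form_subspace[OF a_form \<open>subspace D'\<close>] by (auto simp: D'_def)
    show "\<exists>c. \<forall>y\<in>D'. c * (nrm y)\<^sup>2 \<le> Re (a y y)"
      using lb by (auto simp: D'_def)
  next
    fix s u
    assume s: "(\<forall>n. s n \<in> D') \<and> hconv ip s u \<and>
        (\<forall>e>0. \<exists>N. \<forall>m\<ge>N. \<forall>n\<ge>N. \<bar>Re (a (s n - s m) (s n - s m))\<bar> < e)"
    have sV': "s n \<in> V" for n using s by (auto simp: D'_def)
    have u: "u \<in> V" and lim: "(\<lambda>n. Re (p (s n - u) (s n - u))) \<longlonglongrightarrow> 0"
      using a_closedD[of s u] s sV' by blast+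
    have "\<exists>x\<in>D. Re (p (x - u) (x - u)) < e" if e: "e > 0" for e
    proof -
      have "e / 4 > 0" using e by simp
      then have "eventually (\<lambda>n. Re (p (s n - u) (s n - u)) < e / 4) sequentially"
        using lim by (rule order_tendstoD(2)[rotated])
      then obtain n where n: "Re (p (s n - u) (s n - u)) < e / 4"
        using eventually_happens'[OF sequentially_bot] by blast
      obtain x where x: "x \<in> D" "Re (p (x - s n) (x - s n)) < e / 4"
        using s \<open>e / 4 > 0\<close> unfolding D'_def by blast
      show ?thesis
        using chain[OF DV[OF x(1)] sV'[of n] u] x n by (intro bexI[of _ x]) auto
    qed
    then show "u \<in> D'" using u by (simp add: D'_def)
    have "(\<lambda>n. Re (p (s n - u) (s n - u)) - (1 - lb) * (nrm (s n - u))\<^sup>2) \<longlonglongrightarrow> 0 - (1 - lb) * 0\<^sup>2"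
      using lim s by (intro tendsto_intros hconvD) auto
    then show "(\<lambda>n. Re (a (s n - u) (s n - u))) \<longlonglongrightarrow> 0" by (simp add: Re_p)
  qed
  moreover have "form_ext D (\<lambda>x y. ip (A x) y) D' a"
    using \<open>D \<subseteq> D'\<close> a_on_D by (auto simp: form_ext_def)
  ultimately have "V \<subseteq> D'" by (rule closure_minimal)
  then show ?thesis using assms by (auto simp: D'_def)
qed

text \<open>Both sides are continuous in \<open>y\<close> for the form norm and agree on
  \<open>D\<close>, which is dense in \<open>V\<close> for that norm. As a consequence
  \<open>a\<close> pairs kernel vectors of \<open>A\<close> to zero with all of \<open>V\<close>,
  not only with \<open>D\<close>.\<close>

lemma a_representation:
  assumes x: "x \<in> D" and y: "y \<in> V"
  shows "a x y = ip (A x) y"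
proof (rule ccontr)
  assume neq: "a x y \<noteq> ip (A x) y"
  define d where "d = cmod (a x y - ip (A x) y)"
  \<comment> \<open>A bound, relative to the form norm, for the functional
    \<open>a x w - ip (A x) w\<close> of \<open>w\<close>: one summand each for \<open>p\<close>,
    for the shift and for the pairing with \<open>A x\<close>.\<close>
  define K where "K = sqrt (Re (p x x)) + \<bar>1 - lb\<bar> * nrm x + nrm (A x)"
  have d: "d > 0" using neq by (simp add: d_def)
  have xV: "x \<in> V" using x D_subset_V by blast
  have K: "K \<ge> 0" by (simp add: K_def p_nonneg[OF xV])
  define e where "e = d / (K + 1)"
  have e: "e > 0" using d K by (simp add: e_def)
  obtain z where z: "z \<in> D" "Re (p (z - y) (z - y)) < e\<^sup>2"
    using D_core[OF y, of "e\<^sup>2"] e by auto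
  define w where "w = y - z"
  have zV: "z \<in> V" using z D_subset_V by blast
  have wV: "w \<in> V" using y zV by (simp add: w_def subspace_diff[OF V_subspace])
  have "Re (p w w) < e\<^sup>2"
    using z(2) form_square_minus_commute[OF p_form y zV] by (simp add: w_def)
  then have pw: "sqrt (Re (p w w)) \<le> e" using e by (intro real_le_lsqrt) auto
  then have nw: "nrm w \<le> e" using nrm_le_p[OF wV] by linarith
  have "a x y - ip (A x) y = a x w - ip (A x) w"
    using a_on_D[OF x z(1)] form_diff_right[OF a_form xV y zV] by (simp add: w_def ip_diff_right)
  also have "\<dots> = p x w - of_real (1 - lb) * ip x w - ip (A x) w" by (simp add: p_def)
  finally have "d \<le> cmod (p x w) + \<bar>1 - lb\<bar> * cmod (ip x w) + cmod (ip (A x) w)"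
    unfolding d_def
    by (smt (verit) norm_mult norm_of_real norm_triangle_ineq4)
  moreover have "cmod (p x w) \<le> sqrt (Re (p x x)) * e"
    using form_Cauchy_Schwarz_sqrt[OF p_form p_nonneg xV wV] pw p_nonneg[OF xV]
    by (meson mult_left_mono order_trans real_sqrt_ge_zero)
  moreover have "cmod (ip x w) \<le> nrm x * e"
    using ip_Cauchy_Schwarz[of x w] nw by (meson mult_left_mono order_trans nrm_nonneg)
  then have "\<bar>1 - lb\<bar> * cmod (ip x w) \<le> \<bar>1 - lb\<bar> * (nrm x * e)"
    by (intro mult_left_mono) auto
  moreover have "cmod (ip (A x) w) \<le> nrm (A x) * e"
    using ip_Cauchy_Schwarz[of "A x" w] nw by (meson mult_left_mono order_trans nrm_nonneg)
  ultimately have "d \<le> K * e" by (simp add: K_def algebra_simps)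
  also have "\<dots> < d" using d K by (simp add: e_def field_simps)
  finally show False by simp
qed

end

subsection \<open>The nonpositive spectrum\<close>

context self_adjoint_with_form
begin

lemma eigenvectors_orthogonal:
  assumes "x \<in> D" "A x = sc (of_real \<mu>) x" "y \<in> D" "A y = sc (of_real \<nu>) y" "\<mu> \<noteq> \<nu>"
  shows "ip x y = 0"
proof -
  have "of_real \<mu> * ip x y = of_real \<nu> * ip x y"
    using A_symmetric[OF assms(1,3)] by (simp add: assms(2,4) ip_scale_left ip_scale_right)
  then show ?thesis using assms(5) by simp
qed

lemma eigenvalue_ge_lb:
  assumes "x \<in> D" "A x = sc (of_real \<mu>) x" "x \<noteq> 0"
  shows "lb \<le> \<mu>"
proof -
  have "lb * (nrm x)\<^sup>2 \<le> \<mu> * (nrm x)\<^sup>2"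
    using lb[of x] D_subset_V assms by (auto simp: a_on_D ip_scale_left ip_self)
  then show ?thesis
    using nrm_pos[OF assms(3)] by (meson mult_right_le_imp_le zero_less_power)
qed

text \<open>With \<open>g = (A - i)\<^sup>-\<^sup>1 y\<close> and \<open>s = a - \<theta>\<close>, one has \<open>s[y] = s[A g] + s[g]\<close>, so a minimizing sequence
  \<open>y\<^sub>k\<close> of the Rayleigh quotient is turned into a relatively compact sequence \<open>g\<^sub>k\<close> of
  approximate eigenvectors.\<close>
lemma Rayleigh_minimizer:
  assumes E: "\<forall>e\<in>E. e \<in> D \<and> (\<exists>\<mu>. A e = sc (of_real \<mu>) e)"
    and ne: "y0 \<in> V" "y0 \<noteq> 0" "\<forall>e\<in>E. ip y0 e = 0"
  shows "\<exists>\<theta> g. g \<in> D \<and> g \<noteq> 0 \<and> A g = sc (of_real \<theta>) g \<and> (\<forall>e\<in>E. ip g e = 0) \<and>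
    (\<forall>y\<in>V. (\<forall>e\<in>E. ip y e = 0) \<longrightarrow> \<theta> * (nrm y)\<^sup>2 \<le> Re (a y y))"
proof -
  define U where "U = {y \<in> V. \<forall>e\<in>E. ip y e = 0}"
  have UV: "U \<subseteq> V" by (auto simp: U_def)
  have U_sub: "subspace U"
    unfolding subspace_def U_def using V_subspace
    by (auto simp: subspace_def ip_add_left ip_scale_left)
  define Q where "Q = {Re (a y y) |y. y \<in> U \<and> nrm y = 1}"
  define \<theta> where "\<theta> = Inf Q"
  have bdd: "bdd_below Q"
  proof (rule bdd_belowI[of _ lb])
    fix x assume "x \<in> Q"
    then obtain y where "y \<in> U" "nrm y = 1" "x = Re (a y y)" by (auto simp: Q_def)
    then show "lb \<le> x" using lb[of y] UV by auto
  qed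
  have normalize: "sc (of_real (1 / nrm y)) y \<in> U \<and> nrm (sc (of_real (1 / nrm y)) y) = 1
      \<and> Re (a (sc (of_real (1 / nrm y)) y) (sc (of_real (1 / nrm y)) y)) = Re (a y y) / (nrm y)\<^sup>2"
    if "y \<in> U" "y \<noteq> 0" for y
  proof -
    have y: "y \<in> V" using that UV by blast
    show ?thesis
      using that nrm_pos[OF that(2)] form_square_scale[OF a_form y, of "of_real (1 / nrm y)"]
      by (simp add: subspace_scale[OF U_sub] nrm_scale norm_divide power_divide)
  qed
  have Re_ge: "Re (a y y) \<ge> \<theta> * (nrm y)\<^sup>2" if y: "y \<in> U" for y
  proof (cases "y = 0")
    case True
    then show ?thesis using form_zero_left[OF a_form subspace_0[OF V_subspace]] by simp
  next
    case False
    let ?z = "sc (of_real (1 / nrm y)) y"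
    have "Re (a ?z ?z) \<in> Q"
      unfolding Q_def using normalize[OF y False] by blast
    then have "Re (a y y) / (nrm y)\<^sup>2 \<in> Q"
      using normalize[OF y False] by (simp only:)
    then have "\<theta> \<le> Re (a y y) / (nrm y)\<^sup>2"
      unfolding \<theta>_def using bdd by (rule cInf_lower)
    then show ?thesis using False by (simp add: pos_le_divide_eq)
  qed
  have "y0 \<in> U" using ne by (simp add: U_def)
  then have "Q \<noteq> {}" using normalize[OF _ ne(2)] unfolding Q_def by blast
  have "\<exists>y. y \<in> U \<and> nrm y = 1 \<and> Re (a y y) < \<theta> + 1 / Suc n" for n
  proof -
    have "Inf Q < \<theta> + 1 / Suc n" by (simp add: \<theta>_def)
    then obtain x where "x \<in> Q" "x < \<theta> + 1 / Suc n"
      using cInf_lessD[OF \<open>Q \<noteq> {}\<close>] by blast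
    then show ?thesis by (auto simp: Q_def)
  qed
  then obtain y where yU: "\<And>n. y n \<in> U" and y1: "\<And>n. nrm (y n) = 1"
    and ymin: "\<And>n. Re (a (y n) (y n)) < \<theta> + 1 / Suc n" by metis
  define s where "s x y = a x y + of_real (- \<theta>) * ip x y" for x y
  have s_form: "hermitian_form sc U s"
    unfolding s_def by (rule hermitian_form_subspace[OF hermitian_form_add_ip[OF a_form] U_sub UV])
  have s_nonneg: "0 \<le> Re (s y y)" if "y \<in> U" for y
    using Re_ge[OF that] by (simp add: s_def ip_self)
  define g where "g n = R (y n)" for n
  have gD: "g n \<in> D" for n by (simp add: g_def R_in_D)
  have Ag: "A (g n) = y n + sc \<i> (g n)" for n by (simp add: g_def A_R)
  have gU: "g n \<in> U" for n
  proof -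
    \<comment> \<open>Pairing \<open>(A - \<i>) g = y\<close> with \<open>e\<close> gives
      \<open>(\<mu> - \<i>) ip g e = ip y e = 0\<close> with real \<open>\<mu>\<close>: the
      resolvent preserves the orthogonality constraints.\<close>
    have "ip (g n) e = 0" if e: "e \<in> E" for e
    proof -
      obtain \<mu> where \<mu>: "e \<in> D" "A e = sc (of_real \<mu>) e" using E e by blast
      have "ip (y n) e + \<i> * ip (g n) e = of_real \<mu> * ip (g n) e"
        using A_symmetric[OF gD[of n] \<mu>(1)] by (simp add: \<mu>(2) Ag ip_add_left ip_scale_left ip_scale_right)
      moreover have "ip (y n) e = 0" using yU e by (auto simp: U_def)
      moreover have "\<i> \<noteq> of_real \<mu>" by (simp add: complex_eq_iff)
      ultimately show ?thesis by simp
    qed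
    then show ?thesis using gD D_subset_V by (auto simp: U_def)
  qed
  have AgU: "A (g n) \<in> U" for n
    unfolding Ag by (intro subspace_add[OF U_sub] subspace_scale[OF U_sub] yU gU)
  define h where "h n = Re (ip (A (g n)) (g n))" for n
  have h: "ip (A (g n)) (g n) = of_real (h n)" for n
    using A_symmetric[OF gD[of n] gD[of n]] ip_sym[of "A (g n)" "g n"]
    by (simp add: h_def complex_eq_iff)
  have h': "ip (g n) (A (g n)) = of_real (h n)" for n
    using A_symmetric[OF gD[of n] gD[of n]] h by simp
  define r where "r n = (nrm (A (g n)))\<^sup>2 - \<theta> * h n" for n
  have s_gAg: "s (g n) (A (g n)) = of_real (r n)" for n
  proof -
    have "A (g n) \<in> V" using AgU UV by blast
    then show ?thesis
      by (simp add: s_def a_representation[OF gD] ip_self h' r_def)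
  qed
  have s_Agg: "s (A (g n)) (g n) = of_real (r n)" for n
    using form_sym[OF s_form gU AgU, of n n] by (simp add: s_gAg)
  have s_gg: "Re (s (g n) (g n)) = h n - \<theta> * (nrm (g n))\<^sup>2" for n
    using a_on_D[OF gD gD, of n n] by (simp add: s_def h ip_self)
  have igU: "sc \<i> (g n) \<in> U" for n by (rule subspace_scale[OF U_sub gU])
  have y_eq: "y n = A (g n) - sc \<i> (g n)" for n by (simp add: Ag)
  \<comment> \<open>The cross term is the real part of an imaginary multiple of
    \<open>s (A (g n)) (g n)\<close>, which is the real number \<open>r n\<close>.\<close>
  have s_sum: "Re (s (y n) (y n)) = Re (s (A (g n)) (A (g n))) + Re (s (g n) (g n))" for n
    unfolding y_eq using form_square_diff[OF s_form AgU igU, of n n]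
      form_square_scale[OF s_form gU, of \<i> n] form_scale_right[OF s_form AgU gU, of n \<i> n]
    by (simp add: s_Agg)
  \<comment> \<open>The same cancellation for the inner product. It keeps the limit \<open>l\<close>
    below from being zero, as \<open>g\<close> tends to \<open>l\<close> and \<open>A g\<close> to
    \<open>\<theta> l\<close> along a subsequence.\<close>
  have nrm_sum: "(nrm (A (g n)))\<^sup>2 + (nrm (g n))\<^sup>2 = 1" for n
  proof -
    have "(nrm (y n))\<^sup>2 = (nrm (A (g n)))\<^sup>2 + (nrm (g n))\<^sup>2"
      unfolding y_eq by (simp add: nrm_sq_diff nrm_scale ip_scale_right h)
    then show ?thesis by (simp add: y1)
  qed
  define \<epsilon> where "\<epsilon> n = Re (s (y n) (y n))" for n
  have \<epsilon>_small: "\<epsilon> n \<le> 1 / Suc n" for n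
    using ymin[of n] by (simp add: \<epsilon>_def s_def ip_self y1)
  have sg_le: "0 \<le> Re (s (g n) (g n))" "Re (s (g n) (g n)) \<le> \<epsilon> n" for n
    using s_sum[of n] s_nonneg[OF gU[of n]] s_nonneg[OF AgU[of n]] by (auto simp: \<epsilon>_def)
  \<comment> \<open>Cauchy-Schwarz for \<open>s\<close> on the pair \<open>g\<close>,
    \<open>A g\<close>, whose quadratic values are nonnegative and add up to
    \<open>\<epsilon> n\<close>.\<close>
  have r_le: "\<bar>r n\<bar> \<le> \<epsilon> n" for n
  proof -
    have "(r n)\<^sup>2 \<le> Re (s (g n) (g n)) * Re (s (A (g n)) (A (g n)))"
      using form_Cauchy_Schwarz[OF s_form s_nonneg gU AgU, of n n] by (simp add: s_gAg)
    also have "\<dots> \<le> \<epsilon> n * \<epsilon> n"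
      using s_sum[of n] s_nonneg[OF gU[of n]] s_nonneg[OF AgU[of n]]
      by (intro mult_mono) (auto simp: \<epsilon>_def)
    finally have "(r n)\<^sup>2 \<le> (\<epsilon> n)\<^sup>2" by (simp add: power2_eq_square)
    moreover have "0 \<le> \<epsilon> n" using sg_le[of n] by linarith
    ultimately show ?thesis using abs_le_square_iff[of "r n" "\<epsilon> n"] by simp
  qed
  have res: "(nrm (A (g n) - sc (of_real \<theta>) (g n)))\<^sup>2 \<le> (1 + \<bar>\<theta>\<bar>) * (1 / Suc n)" for n
  proof -
    \<comment> \<open>The expanded square regroups into two quantities already controlled by
      \<open>\<epsilon> n\<close>.\<close>
    have "(nrm (A (g n) - sc (of_real \<theta>) (g n)))\<^sup>2 = r n - \<theta> * Re (s (g n) (g n))"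
      by (simp add: nrm_sq_diff nrm_scale ip_scale_right h r_def s_gg power_mult_distrib)
        (simp add: power2_eq_square algebra_simps)
    also have "\<dots> \<le> \<bar>r n\<bar> + \<bar>\<theta>\<bar> * \<bar>Re (s (g n) (g n))\<bar>"
      using abs_ge_self[of "r n"] abs_ge_minus_self[of "\<theta> * Re (s (g n) (g n))"]
      unfolding abs_mult by linarith
    also have "\<dots> \<le> 1 * \<epsilon> n + \<bar>\<theta>\<bar> * \<epsilon> n"
      using r_le[of n] sg_le[of n] by (intro add_mono mult_left_mono) auto
    also have "\<dots> = (1 + \<bar>\<theta>\<bar>) * \<epsilon> n" by (simp add: distrib_right)
    also have "\<dots> \<le> (1 + \<bar>\<theta>\<bar>) * (1 / Suc n)" by (intro mult_left_mono \<epsilon>_small) auto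
    finally show ?thesis .
  qed
  have lim_inv: "(\<lambda>n. (1 + \<bar>\<theta>\<bar>) * (1 / Suc n)) \<longlonglongrightarrow> 0"
    using tendsto_mult_right_zero[OF LIMSEQ_inverse_real_of_nat, of "1 + \<bar>\<theta>\<bar>"]
    by (simp add: inverse_eq_divide)
  have "(\<lambda>n. (nrm (A (g n) - sc (of_real \<theta>) (g n)))\<^sup>2) \<longlonglongrightarrow> 0"
    by (rule Lim_null_comparison[OF _ lim_inv]) (use res in simp)
  then have lim_res: "(\<lambda>n. nrm (A (g n) - sc (of_real \<theta>) (g n))) \<longlonglongrightarrow> 0"
    using tendsto_real_sqrt by fastforce
  obtain q l where q: "strict_mono q" and gl: "hconv ip (\<lambda>n. g (q n)) l"
    using R_compact[of y 1] y1 by (auto simp: g_def)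
  have "hconv ip (\<lambda>n. sc (of_real \<theta>) (g (q n))) (sc (of_real \<theta>) l)"
    by (rule hconv_scale[OF gl])
  then have Agl: "hconv ip (\<lambda>n. A (g (q n))) (sc (of_real \<theta>) l)"
    by (rule hconv_diff_small) (use LIMSEQ_subseq_LIMSEQ[OF lim_res q] in \<open>simp add: o_def\<close>)
  have l: "l \<in> D" "A l = sc (of_real \<theta>) l"
    using A_closed[OF gD gl Agl] by auto
  have "(\<lambda>n. (nrm (A (g (q n))))\<^sup>2 + (nrm (g (q n)))\<^sup>2) \<longlonglongrightarrow> (nrm (sc (of_real \<theta>) l))\<^sup>2 + (nrm l)\<^sup>2"
    by (intro tendsto_intros hconv_nrm gl Agl)
  then have "(nrm (sc (of_real \<theta>) l))\<^sup>2 + (nrm l)\<^sup>2 = 1"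
    by (simp add: nrm_sum LIMSEQ_const_iff)
  then have "l \<noteq> 0" by (auto simp: nrm_scale)
  have "\<forall>e\<in>E. ip l e = 0"
  proof (intro ballI)
    fix e assume "e \<in> E"
    show "ip l e = 0"
    proof (rule LIMSEQ_unique)
      show "(\<lambda>n. ip (g (q n)) e) \<longlonglongrightarrow> ip l e" by (rule hconv_ip_left[OF gl])
      show "(\<lambda>n. ip (g (q n)) e) \<longlonglongrightarrow> 0" using gU \<open>e \<in> E\<close> by (simp add: U_def)
    qed
  qed
  moreover have "\<forall>y\<in>V. (\<forall>e\<in>E. ip y e = 0) \<longrightarrow> \<theta> * (nrm y)\<^sup>2 \<le> Re (a y y)"
    using Re_ge by (simp add: U_def)
  ultimately show ?thesis using l \<open>l \<noteq> 0\<close> by blast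
qed

text \<open>The eigenvalues lie in \<open>[lb, 0]\<close>, so for a sequence \<open>y\<close> of
  such vectors \<open>(A - \<i>) y\<close> stays bounded and the compact resolvent makes a
  subsequence of \<open>y\<close> converge. Distinct orthonormal vectors, however, have distance
  \<open>sqrt 2\<close>.\<close>

lemma orthonormal_nonpos_eigenvectors_finite:
  assumes B: "orthonormal B" and ev: "\<And>e. e \<in> B \<Longrightarrow> e \<in> D \<and> (\<exists>\<mu>\<le>0. A e = sc (of_real \<mu>) e)"
  shows "finite B"
proof (rule ccontr)
  assume "infinite B"
  then obtain y :: "nat \<Rightarrow> 'h" where y: "inj y" "range y \<subseteq> B"
    using infinite_countable_subset by blast
  have yB: "y n \<in> B" for n using y by blast
  then have yD: "y n \<in> D" for n using ev by blast
  have y1: "nrm (y n) = 1" for n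
    using B yB[of n] nrm_sq[of "y n"] power2_eq_1_iff[of "nrm (y n)"] nrm_nonneg[of "y n"]
    by (auto simp: orthonormal_def)
  have bound: "nrm (A (y n) - sc \<i> (y n)) \<le> \<bar>lb\<bar> + 1" for n
  proof -
    obtain \<mu> where \<mu>: "\<mu> \<le> 0" "A (y n) = sc (of_real \<mu>) (y n)" using ev yB by blast
    have "y n \<noteq> 0" using y1[of n] by auto
    then have "lb \<le> \<mu>" using eigenvalue_ge_lb[OF yD \<mu>(2)] by blast
    have "A (y n) - sc \<i> (y n) = sc (of_real \<mu> - \<i>) (y n)"
      by (simp add: \<mu>(2) scale_left_diff_distrib)
    then have "nrm (A (y n) - sc \<i> (y n)) = cmod (of_real \<mu> - \<i>)" by (simp add: nrm_scale y1)
    also have "\<dots> \<le> \<bar>\<mu>\<bar> + 1" using norm_triangle_ineq4[of "of_real \<mu>" \<i>] by simp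
    finally show ?thesis using \<open>lb \<le> \<mu>\<close> \<mu>(1) by linarith
  qed
  obtain r l where r: "strict_mono r" "hconv ip (\<lambda>n. R (A (y (r n)) - sc \<i> (y (r n)))) l"
    using R_compact[of "\<lambda>n. A (y n) - sc \<i> (y n)", OF bound] by blast
  then have "hconv ip (\<lambda>n. y (r n)) l" by (simp add: R_inverse yD)
  then have "eventually (\<lambda>n. nrm (y (r n) - l) < 1/2) sequentially"
    by (intro order_tendstoD(2)[OF hconvD]) auto
  then obtain N where N: "\<And>n. n \<ge> N \<Longrightarrow> nrm (y (r n) - l) < 1/2"
    unfolding eventually_sequentially by blast
  have "nrm (y (r N) - y (r (Suc N))) < 1"
    using nrm_triangle_diff[of "y (r N)" "y (r (Suc N))" l] N[of N] N[of "Suc N"]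
      nrm_minus_commute[of l "y (r (Suc N))"] by simp
  then have "(nrm (y (r N) - y (r (Suc N))))\<^sup>2 < 1" by (simp add: power_less_one_iff)
  moreover have "y (r N) \<noteq> y (r (Suc N))"
    using y(1) r(1) by (simp add: inj_eq strict_mono_eq)
  then have "ip (y (r N)) (y (r (Suc N))) = 0"
    using B yB by (auto simp: orthonormal_def)
  ultimately show False by (simp add: nrm_sq_diff y1)
qed

text \<open>Zorn's lemma for orthonormal families of eigenvectors whose nonpositive eigenvalues may
  differ. A further eigenvector orthogonal to a maximal family could be normalized and
  adjoined.\<close>

lemma maximal_nonpos_eigenvectors:
  obtains B where "finite B" "orthonormal B" "\<And>e. e \<in> B \<Longrightarrow> e \<in> D \<and> (\<exists>\<mu>\<le>0. A e = sc (of_real \<mu>) e)"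
    "\<And>y \<mu>. y \<in> D \<Longrightarrow> \<mu> \<le> 0 \<Longrightarrow> A y = sc (of_real \<mu>) y \<Longrightarrow> (\<And>e. e \<in> B \<Longrightarrow> ip y e = 0) \<Longrightarrow> y = 0"
proof -
  define E where "E = {e \<in> D. \<exists>\<mu>\<le>0. A e = sc (of_real \<mu>) e}"
  define \<A> where "\<A> = {B. B \<subseteq> E \<and> orthonormal B}"
  have "\<exists>M\<in>\<A>. \<forall>X\<in>\<A>. M \<subseteq> X \<longrightarrow> X = M"
  proof (rule subset_Zorn')
    fix C assume C: "subset.chain \<A> C"
    have "ip x y = (if x = y then 1 else 0)" if xy: "x \<in> \<Union>C" "y \<in> \<Union>C" for x y
    proof -
      obtain X Y where XY: "X \<in> C" "Y \<in> C" "x \<in> X" "y \<in> Y" using xy by blast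
      then have "X \<subseteq> Y \<or> Y \<subseteq> X" using C unfolding subset.chain_def by blast
      then obtain Z where "Z \<in> C" "x \<in> Z" "y \<in> Z" using XY by blast
      moreover from this have "orthonormal Z" using C unfolding subset.chain_def \<A>_def by blast
      ultimately show ?thesis unfolding orthonormal_def by blast
    qed
    moreover have "\<Union>C \<subseteq> E" using C unfolding subset.chain_def \<A>_def by blast
    ultimately show "\<Union>C \<in> \<A>" unfolding \<A>_def orthonormal_def by blast
  qed
  then obtain B where "B \<in> \<A>" and max': "\<forall>X\<in>\<A>. B \<subseteq> X \<longrightarrow> X = B" by (rule bexE)
  then have B: "B \<subseteq> E" "orthonormal B" by (simp_all add: \<A>_def)
  have max: "X = B" if "X \<subseteq> E" "orthonormal X" "B \<subseteq> X" for X
    using max' that by (simp add: \<A>_def)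
  have ev: "e \<in> D \<and> (\<exists>\<mu>\<le>0. A e = sc (of_real \<mu>) e)" if "e \<in> B" for e
    using that B(1) by (auto simp: E_def)
  show ?thesis
  proof (rule that[OF orthonormal_nonpos_eigenvectors_finite[OF B(2) ev] B(2) ev])
    fix y \<mu> assume y: "y \<in> D" "\<mu> \<le> 0" "A y = sc (of_real \<mu>) y" and orth: "\<And>e. e \<in> B \<Longrightarrow> ip y e = 0"
    show "y = 0"
    proof (rule ccontr)
      assume "y \<noteq> 0"
      define z where "z = sc (of_real (1 / nrm y)) y"
      have z1: "nrm z = 1" using \<open>y \<noteq> 0\<close> by (simp add: z_def nrm_scale norm_divide)
      have zB: "ip z e = 0" "ip e z = 0" if "e \<in> B" for e
        using orth[OF that] ip_sym[of y e] by (simp_all add: z_def ip_scale_left ip_scale_right)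
      have "A z = sc (of_real \<mu>) z"
        by (simp add: z_def A_scale y(1,3) mult.commute)
      then have "z \<in> E"
        using y(1,2) subspace_scale[OF D_subspace y(1)] by (auto simp: E_def z_def)
      then have "insert z B \<subseteq> E" using B by blast
      moreover have "orthonormal (insert z B)"
        using B(2) zB z1 ip_self[of z] unfolding orthonormal_def by auto
      ultimately have "insert z B = B" using max by blast
      then have "z \<in> B" by blast
      then show False using zB(1)[of z] ip_self[of z] z1 by simp
    qed
  qed
qed

section \<open>Eigenspaces and the finite spectral basis\<close>

lemma eigenspace_subspace: "subspace (eigenspace_op sc D A \<mu>)"
  unfolding subspace_def eigenspace_op_def
  using D_subspace by (auto simp: subspace_def A_add A_scale A_zero scale_right_distrib mult.commute)

lemma span_eigenvectors:
  assumes B: "finite B" "orthonormal B" "\<And>e. e \<in> B \<Longrightarrow> e \<in> D \<and> A e = sc (of_real (\<mu> e)) e"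
    and y: "y \<in> span B"
  shows "y \<in> D" "Re (a y y) = (\<Sum>e\<in>B. \<mu> e * (cmod (ip y e))\<^sup>2)"
proof -
  show yD: "y \<in> D"
    using span_minimal[OF _ D_subspace, of B] B(3) y by blast
  have "ip (A y) e = of_real (\<mu> e) * ip y e" if "e \<in> B" for e
    using A_symmetric[OF yD, of e] B(3)[OF that] by (simp add: ip_scale_right)
  then have Ae: "cnj (ip y e) * ip (A y) e = of_real (\<mu> e * (cmod (ip y e))\<^sup>2)" if "e \<in> B" for e
    using that by (simp only: of_real_mult complex_norm_square mult_ac)
  have "a y y = ip (A y) (proj B y)"
    using a_on_D[OF yD yD] proj_span[OF B(2,1) y] by simp
  also have "\<dots> = (\<Sum>e\<in>B. of_real (\<mu> e * (cmod (ip y e))\<^sup>2))"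
    unfolding proj_def ip_sum_right ip_scale_right by (rule sum.cong[OF refl Ae])
  finally show "Re (a y y) = (\<Sum>e\<in>B. \<mu> e * (cmod (ip y e))\<^sup>2)" by simp
qed

text \<open>\<open>Bm\<close> and \<open>B0\<close> collect the members of a maximal family with
  negative and with zero eigenvalue. The gap below zero exists because \<open>Bm\<close> is finite.
  The gap above zero is the infimum of the Rayleigh quotient on the complement: it is attained at an
  eigenvector, and maximality forbids a nonpositive eigenvalue there.\<close>

lemma nonpos_spectral_basis:
  shows "\<exists>Bm B0 \<kappa>. finite Bm \<and> finite B0 \<and> Bm \<inter> B0 = {} \<and> orthonormal (Bm \<union> B0) \<and>
    card Bm = neg_count sc D A \<and> card B0 = dim (eigenspace_op sc D A 0) \<and>
    span (Bm \<union> B0) \<subseteq> D \<and> span B0 = eigenspace_op sc D A 0 \<and> \<kappa> > 0 \<and>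
    (\<forall>y\<in>span Bm. Re (a y y) \<le> - \<kappa> * (nrm y)\<^sup>2) \<and>
    (\<forall>y\<in>span (Bm \<union> B0). Re (a y y) \<le> 0) \<and>
    (\<forall>y\<in>V. (\<forall>e\<in>Bm. ip y e = 0) \<longrightarrow> 0 \<le> Re (a y y)) \<and>
    (\<forall>y\<in>V. (\<forall>e\<in>Bm \<union> B0. ip y e = 0) \<longrightarrow> \<kappa> * (nrm y)\<^sup>2 \<le> Re (a y y))"
proof -
  obtain B where B: "finite B" "orthonormal B"
    and ev: "\<And>e. e \<in> B \<Longrightarrow> e \<in> D \<and> (\<exists>\<mu>\<le>0. A e = sc (of_real \<mu>) e)"
    and max: "\<And>y \<mu>. y \<in> D \<Longrightarrow> \<mu> \<le> 0 \<Longrightarrow> A y = sc (of_real \<mu>) y \<Longrightarrow> (\<And>e. e \<in> B \<Longrightarrow> ip y e = 0) \<Longrightarrow> y = 0"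
  proof (rule maximal_nonpos_eigenvectors, goal_cases)
    case (1 B)
    show ?case by (rule 1(1)[OF 1(2-5)])
  qed
  have "\<forall>e\<in>B. \<exists>\<mu>. \<mu> \<le> 0 \<and> A e = sc (of_real \<mu>) e" using ev by blast
  from bchoice[OF this] obtain \<mu> where \<mu>: "\<And>e. e \<in> B \<Longrightarrow> \<mu> e \<le> 0 \<and> A e = sc (of_real (\<mu> e)) e"
    by blast
  have B_nz: "e \<noteq> 0" if "e \<in> B" for e
    using B(2)[unfolded orthonormal_def, rule_format, OF that that] by auto
  define Bm where "Bm = {e \<in> B. \<mu> e < 0}"
  define B0 where "B0 = {e \<in> B. \<mu> e = 0}"
  have BB: "Bm \<union> B0 = B" using \<mu> by (fastforce simp: Bm_def B0_def)
  have fin: "finite Bm" "finite B0" using B(1) by (auto simp: Bm_def B0_def)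
  have eig_span: "eigenspace_op sc D A \<nu> = span {e \<in> B. \<mu> e = \<nu>}" if \<nu>: "\<nu> \<le> 0" for \<nu>
  proof
    let ?S = "{e \<in> B. \<mu> e = \<nu>}"
    have S: "finite ?S" "orthonormal ?S" using B orthonormal_subset[OF B(2), of ?S] by auto
    have S_eig: "?S \<subseteq> eigenspace_op sc D A \<nu>" using ev \<mu> by (auto simp: eigenspace_op_def)
    show span_sub: "span ?S \<subseteq> eigenspace_op sc D A \<nu>"
      by (rule span_minimal[OF S_eig eigenspace_subspace])
    show "eigenspace_op sc D A \<nu> \<subseteq> span ?S"
    proof
      fix y assume y: "y \<in> eigenspace_op sc D A \<nu>"
      \<comment> \<open>The remainder is an eigenvector for \<open>\<nu>\<close> orthogonal to all
        of \<open>B\<close>: to \<open>?S\<close> by construction, to the other members because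
        their eigenvalues differ. Maximality makes it zero.\<close>
      define z where "z = y - proj ?S y"
      have "z \<in> eigenspace_op sc D A \<nu>"
        unfolding z_def using span_sub proj_in_span y by (blast intro: subspace_diff[OF eigenspace_subspace])
      then have z: "z \<in> D" "A z = sc (of_real \<nu>) z" by (auto simp: eigenspace_op_def)
      have "ip z e = 0" if e: "e \<in> B" for e
      proof (cases "\<mu> e = \<nu>")
        case True
        then show ?thesis using ip_proj[OF S(2,1), of e y] e by (simp add: z_def ip_diff_left)
      next
        case False
        then show ?thesis
          using eigenvectors_orthogonal[OF z, of e "\<mu> e"] e ev \<mu> by auto
      qed
      then have "z = 0" using max[OF z(1) \<nu> z(2)] by blast
      then have "y = proj ?S y" by (simp add: z_def)
      then show "y \<in> span ?S" using proj_in_span[of ?S y] by (simp only:)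
    qed
  qed
  have eig_dim: "dim (eigenspace_op sc D A \<nu>) = card {e \<in> B. \<mu> e = \<nu>}" if "\<nu> \<le> 0" for \<nu>
    unfolding eig_span[OF that] dim_span
    by (intro dim_eq_card_independent orthonormal_independent orthonormal_subset[OF B(2)]) auto
  have eig_nz: "eigenspace_op sc D A \<nu> \<noteq> {0} \<longleftrightarrow> \<nu> \<in> \<mu> ` B" if \<nu>: "\<nu> \<le> 0" for \<nu>
  proof
    assume nz: "eigenspace_op sc D A \<nu> \<noteq> {0}"
    have "{e \<in> B. \<mu> e = \<nu>} \<noteq> {}" using nz unfolding eig_span[OF \<nu>] by (metis span_empty)
    then show "\<nu> \<in> \<mu> ` B" by blast
  next
    assume "\<nu> \<in> \<mu> ` B"
    then obtain e where e: "e \<in> B" "\<mu> e = \<nu>" by blast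
    then have "e \<in> eigenspace_op sc D A \<nu>" using ev \<mu> by (auto simp: eigenspace_op_def)
    then show "eigenspace_op sc D A \<nu> \<noteq> {0}" using B_nz[OF e(1)] by blast
  qed
  \<comment> \<open>A sum over an infinite index set is zero by convention, so
    \<open>neg_count\<close> is a true count only once this set is recognized as the image of the
    finite \<open>Bm\<close>.\<close>
  have idx: "{\<nu>. \<nu> < 0 \<and> eigenspace_op sc D A \<nu> \<noteq> {0}} = \<mu> ` Bm"
  proof (rule set_eqI)
    fix \<nu>
    have "\<nu> \<in> \<mu> ` Bm \<longleftrightarrow> \<nu> < 0 \<and> \<nu> \<in> \<mu> ` B" by (auto simp: Bm_def)
    then show "\<nu> \<in> {\<nu>. \<nu> < 0 \<and> eigenspace_op sc D A \<nu> \<noteq> {0}} \<longleftrightarrow> \<nu> \<in> \<mu> ` Bm"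
      using eig_nz[of \<nu>] by (simp only: mem_Collect_eq) linarith
  qed
  have "neg_count sc D A = (\<Sum>\<nu>\<in>\<mu> ` Bm. card {e \<in> Bm. \<mu> e = \<nu>})"
    unfolding neg_count_def idx
  proof (rule sum.cong[OF refl])
    fix \<nu> assume "\<nu> \<in> \<mu> ` Bm"
    then have "\<nu> < 0" by (auto simp: Bm_def)
    moreover from this have "{e \<in> B. \<mu> e = \<nu>} = {e \<in> Bm. \<mu> e = \<nu>}" by (auto simp: Bm_def)
    ultimately show "dim (eigenspace_op sc D A \<nu>) = card {e \<in> Bm. \<mu> e = \<nu>}"
      using eig_dim[of \<nu>] by simp
  qed
  also have "\<dots> = card Bm"
    using sum.image_gen[OF fin(1), of "\<lambda>_. 1::nat" \<mu>] by simp
  finally have negc: "card Bm = neg_count sc D A" ..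
  have ker_span: "span B0 = eigenspace_op sc D A 0" using eig_span[of 0] by (simp add: B0_def)
  have ker_dim: "card B0 = dim (eigenspace_op sc D A 0)" using eig_dim[of 0] by (simp add: B0_def)
  have BD: "span (Bm \<union> B0) \<subseteq> D"
    unfolding BB using ev by (intro span_minimal D_subspace) blast
  \<comment> \<open>The element \<open>1\<close> covers the case without negative
    eigenvalues.\<close>
  define \<kappa>1 where "\<kappa>1 = Min (insert 1 ((\<lambda>e. - \<mu> e) ` Bm))"
  have \<kappa>1: "\<kappa>1 > 0" "\<And>e. e \<in> Bm \<Longrightarrow> \<mu> e \<le> - \<kappa>1"
  proof -
    show "\<kappa>1 > 0" unfolding \<kappa>1_def using fin(1) by (subst Min_gr_iff) (auto simp: Bm_def)
    show "\<mu> e \<le> - \<kappa>1" if "e \<in> Bm" for e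
    proof -
      have "\<kappa>1 \<le> - \<mu> e" unfolding \<kappa>1_def using fin(1) that by (intro Min_le) auto
      then show ?thesis by simp
    qed
  qed
  have neg: "Re (a y y) \<le> - \<kappa>1 * (nrm y)\<^sup>2" if y: "y \<in> span Bm" for y
  proof -
    have on: "orthonormal Bm" by (rule orthonormal_subset[OF B(2)]) (auto simp: Bm_def)
    have "Re (a y y) = (\<Sum>e\<in>Bm. \<mu> e * (cmod (ip y e))\<^sup>2)"
      using ev \<mu> by (intro span_eigenvectors(2)[OF fin(1) on _ y]) (auto simp: Bm_def)
    also have "\<dots> \<le> (\<Sum>e\<in>Bm. - \<kappa>1 * (cmod (ip y e))\<^sup>2)"
      using \<kappa>1(2) by (intro sum_mono mult_right_mono) auto
    also have "\<dots> = - \<kappa>1 * (nrm y)\<^sup>2"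
      by (simp only: sum_distrib_left parseval_span[OF on fin(1) y])
    finally show ?thesis .
  qed
  have nonpos: "Re (a y y) \<le> 0" if y: "y \<in> span (Bm \<union> B0)" for y
  proof -
    have "Re (a y y) = (\<Sum>e\<in>B. \<mu> e * (cmod (ip y e))\<^sup>2)"
      using ev \<mu> y by (intro span_eigenvectors(2)[OF B(1,2)]) (auto simp: BB)
    also have "\<dots> \<le> 0" using \<mu> by (intro sum_nonpos mult_nonpos_nonneg) auto
    finally show ?thesis .
  qed
  have nonneg: "0 \<le> Re (a y y)" if y: "y \<in> V" "\<forall>e\<in>Bm. ip y e = 0" for y
  proof (cases "y = 0")
    case True
    then show ?thesis using form_zero_left[OF a_form subspace_0[OF V_subspace]] by simp
  next
    case False
    have "\<forall>e\<in>Bm. e \<in> D \<and> (\<exists>\<nu>. A e = sc (of_real \<nu>) e)"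
      using ev by (auto simp: Bm_def)
    from Rayleigh_minimizer[OF this y(1) False y(2)]
    obtain \<theta> g where g: "g \<in> D" "g \<noteq> 0" "A g = sc (of_real \<theta>) g" "\<forall>e\<in>Bm. ip g e = 0"
      and ge: "\<forall>y\<in>V. (\<forall>e\<in>Bm. ip y e = 0) \<longrightarrow> \<theta> * (nrm y)\<^sup>2 \<le> Re (a y y)"
      by (elim exE conjE)
    \<comment> \<open>A negative minimum would have an eigenvector orthogonal to all of
      \<open>B\<close>: to \<open>Bm\<close> by the constraint, to the kernel vectors because the
      eigenvalues differ.\<close>
    have "\<theta> \<ge> 0"
    proof (rule ccontr)
      assume "\<not> \<theta> \<ge> 0"
      then have \<theta>: "\<theta> < 0" by simp
      have "ip g e = 0" if e: "e \<in> B" for e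
      proof (cases "e \<in> Bm")
        case False
        then have "\<mu> e \<noteq> \<theta>" using e \<theta> by (auto simp: Bm_def)
        then show ?thesis using eigenvectors_orthogonal[OF g(1,3), of e "\<mu> e"] e ev \<mu> by auto
      qed (use g(4) in blast)
      then have "g = 0" using max[OF g(1) _ g(3)] \<theta> by simp
      then show False using g(2) by simp
    qed
    then have "0 \<le> \<theta> * (nrm y)\<^sup>2" by simp
    also have "\<dots> \<le> Re (a y y)" using ge y by blast
    finally show ?thesis .
  qed
  have "\<exists>\<kappa>>0. \<forall>y\<in>V. (\<forall>e\<in>Bm \<union> B0. ip y e = 0) \<longrightarrow> \<kappa> * (nrm y)\<^sup>2 \<le> Re (a y y)"
  proof (cases "\<exists>y\<in>V. y \<noteq> 0 \<and> (\<forall>e\<in>B. ip y e = 0)")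
    case True
    then obtain y where y: "y \<in> V" "y \<noteq> 0" "\<forall>e\<in>B. ip y e = 0" by blast
    have "\<forall>e\<in>B. e \<in> D \<and> (\<exists>\<nu>. A e = sc (of_real \<nu>) e)"
      using ev by (auto simp: Bm_def)
    from Rayleigh_minimizer[OF this y]
    obtain \<theta> g where g: "g \<in> D" "g \<noteq> 0" "A g = sc (of_real \<theta>) g" "\<forall>e\<in>B. ip g e = 0"
      and ge: "\<forall>y\<in>V. (\<forall>e\<in>B. ip y e = 0) \<longrightarrow> \<theta> * (nrm y)\<^sup>2 \<le> Re (a y y)"
      by (elim exE conjE)
    have "\<theta> > 0"
      using max[OF g(1) _ g(3)] g(2,4) by force
    then show ?thesis unfolding BB using ge by blast
  next
    case False
    \<comment> \<open>Only the zero vector satisfies the constraints here, so any constant serves;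
      \<open>1\<close> is arbitrary.\<close>
    have "Re (a 0 0) = 0" using form_zero_left[OF a_form subspace_0[OF V_subspace]] by simp
    then show ?thesis unfolding BB using False by (intro exI[of _ 1]) auto
  qed
  then obtain \<kappa>2 where \<kappa>2: "\<kappa>2 > 0"
    "\<forall>y\<in>V. (\<forall>e\<in>Bm \<union> B0. ip y e = 0) \<longrightarrow> \<kappa>2 * (nrm y)\<^sup>2 \<le> Re (a y y)"
    by (elim exE conjE)
  define \<kappa> where "\<kappa> = min \<kappa>1 \<kappa>2"
  have \<kappa>_le: "\<kappa> * (nrm y)\<^sup>2 \<le> \<kappa>1 * (nrm y)\<^sup>2" "\<kappa> * (nrm y)\<^sup>2 \<le> \<kappa>2 * (nrm y)\<^sup>2" for y
    by (auto simp: \<kappa>_def intro: mult_right_mono)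
  show ?thesis
  proof (rule exI[of _ Bm], rule exI[of _ B0], rule exI[of _ \<kappa>], intro conjI)
    show "Bm \<inter> B0 = {}" by (auto simp: Bm_def B0_def)
    show "orthonormal (Bm \<union> B0)" using B(2) BB by simp
    show "\<kappa> > 0" using \<kappa>1 \<kappa>2 by (simp add: \<kappa>_def)
    show "\<forall>y\<in>span Bm. Re (a y y) \<le> - \<kappa> * (nrm y)\<^sup>2"
      using neg \<kappa>_le(1) by (smt (verit) mult_minus_left)
    show "\<forall>y\<in>V. (\<forall>e\<in>Bm \<union> B0. ip y e = 0) \<longrightarrow> \<kappa> * (nrm y)\<^sup>2 \<le> Re (a y y)"
      using \<kappa>2(2) \<kappa>_le(2) order_trans by blast
  qed (use nonpos nonneg in \<open>simp_all add: fin negc ker_dim BD ker_span\<close>)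
qed

text \<open>Sokal's proof of the uniform boundedness principle.\<close>
lemma form_norm_uniform_bound:
  assumes pw: "\<forall>y\<in>V. \<exists>M. \<forall>w\<in>W. cmod (ip y w) \<le> M"
  shows "\<exists>M\<ge>0. \<forall>y\<in>V. \<forall>w\<in>W. cmod (ip y w) \<le> M * sqrt (Re (p y y))"
proof (rule ccontr)
  assume unbounded: "\<not> ?thesis"
  define Np where "Np y = sqrt (Re (p y y))" for y
  have Np_nonneg: "0 \<le> Np y" if "y \<in> V" for y using p_nonneg[OF that] by (simp add: Np_def)
  have Np_scale: "Np (sc t y) = cmod t * Np y" if "y \<in> V" for t y
    unfolding Np_def by (simp add: form_square_scale[OF p_form that] real_sqrt_mult)
  have V_diff: "x - y \<in> V" if "x \<in> V" "y \<in> V" for x y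
    by (rule subspace_diff[OF V_subspace that])
  have Np_triangle: "Np (x - z) \<le> Np (x - y) + Np (y - z)" if "x \<in> V" "y \<in> V" "z \<in> V" for x y z
    using form_triangle[OF p_form p_nonneg V_diff[OF that(1,2)] V_diff[OF that(2,3)]]
    by (simp add: Np_def)
  have Np_commute: "Np (x - y) = Np (y - x)" if "x \<in> V" "y \<in> V" for x y
    using form_square_minus_commute[OF p_form that] by (simp add: Np_def)
  define T where "T w = {cmod (ip y w) |y. y \<in> V \<and> Np y \<le> 1}" for w
  \<comment> \<open>The norm of \<open>ip y w\<close>, as a functional of \<open>y\<close>, on
    \<open>V\<close> with the form norm.\<close>
  define op where "op w = Sup (T w)" for w
  have T_bdd: "bdd_above (T w)" for w
  proof (rule bdd_aboveI[of _ "nrm w"])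
    fix x assume "x \<in> T w"
    then obtain y where y: "y \<in> V" "Np y \<le> 1" "x = cmod (ip y w)" by (auto simp: T_def)
    have "x \<le> nrm y * nrm w" using ip_Cauchy_Schwarz y(3) by simp
    also have "\<dots> \<le> 1 * nrm w"
      using order_trans[OF nrm_le_p[OF y(1)]] y(2) by (intro mult_right_mono) (auto simp: Np_def)
    finally show "x \<le> nrm w" by simp
  qed
  have T_ne: "T w \<noteq> {}" for w
  proof -
    have "Np 0 = 0" using form_zero_left[OF p_form subspace_0[OF V_subspace]] by (simp add: Np_def)
    then show ?thesis unfolding T_def using subspace_0[OF V_subspace] by fastforce
  qed
  have op_bound: "cmod (ip y w) \<le> op w * Np y" if y: "y \<in> V" for y w
  proof (cases "y = 0")
    case True
    then show ?thesis
      using form_zero_left[OF p_form subspace_0[OF V_subspace]] by (simp add: Np_def)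
  next
    case False
    then have pos: "Np y > 0"
      unfolding Np_def using less_le_trans[OF nrm_pos nrm_le_p[OF y]] by blast
    let ?z = "sc (of_real (1 / Np y)) y"
    have "cmod (ip ?z w) \<in> T w"
      unfolding T_def using pos Np_scale[OF y, of "of_real (1 / Np y)"]
      by (intro CollectI exI[of _ ?z]) (simp add: subspace_scale[OF V_subspace y] norm_divide)
    then have "cmod (ip ?z w) \<le> op w" unfolding op_def using T_bdd by (rule cSup_upper)
    then show ?thesis using pos by (simp add: ip_scale_left norm_mult norm_divide field_simps)
  qed
  have op_attain: "\<exists>y\<in>V. Np y \<le> 1 \<and> 2 / 3 * op w \<le> cmod (ip y w)" if "op w > 0" for w
  proof -
    have "2 / 3 * op w < Sup (T w)" using that by (simp add: op_def)
    then obtain x where "x \<in> T w" "2 / 3 * op w < x" using less_cSupD[OF T_ne] by blast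
    then show ?thesis by (auto simp: T_def intro!: bexI)
  qed
  have "\<exists>w\<in>W. op w > 4 ^ n" for n
  proof (rule ccontr)
    assume "\<not> ?thesis"
    then have le: "op w \<le> 4 ^ n" if "w \<in> W" for w using that by force
    have "cmod (ip y w) \<le> 4 ^ n * sqrt (Re (p y y))" if "y \<in> V" "w \<in> W" for y w
      using op_bound[OF that(1), of w] mult_right_mono[OF le[OF that(2)] Np_nonneg[OF that(1)]]
      by (simp add: Np_def)
    then show False using unbounded by (metis zero_le_numeral zero_le_power)
  qed
  then obtain w where wW: "\<And>n. w n \<in> W" and w_large: "\<And>n. op (w n) > 4 ^ n" by metis
  have op_pos: "op (w n) > 0" for n using w_large[of n] by (meson less_trans zero_less_numeral zero_less_power)
  obtain y where yV: "\<And>n. y n \<in> V" and y1: "\<And>n. Np (y n) \<le> 1"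
    and y_att: "\<And>n. 2 / 3 * op (w n) \<le> cmod (ip (y n) (w n))"
    using op_attain[OF op_pos] by metis
  \<comment> \<open>Steps of length \<open>3^-n\<close> leave a remainder of at most
    \<open>1/2 * 3^-n\<close> beyond index \<open>Suc n\<close>, while step \<open>n\<close> secures
    \<open>2/3 * 3^-n\<close> times \<open>op (w n)\<close>. The surplus
    \<open>2/3 - 1/2 = 1/6\<close>, together with \<open>op (w n) > 4^n\<close>, makes the values at
    the limit exceed \<open>(4/3)^n / 6\<close>.\<close>
  define t where "t n = sc (of_real ((1/3) ^ n)) (y n)" for n
  have tV: "t n \<in> V" for n by (simp add: t_def subspace_scale[OF V_subspace yV])
  have t_small: "Np (t n) \<le> (1/3) ^ n" for n
    using mult_left_mono[OF y1[of n], of "(1/3) ^ n"] Np_scale[OF yV[of n], of "of_real ((1/3) ^ n)"]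
    by (simp add: t_def norm_power norm_divide power_divide)
  have t_large: "2 / 3 * op (w n) * (1/3) ^ n \<le> cmod (ip (t n) (w n))" for n
    using mult_right_mono[OF y_att[of n], of "(1/3) ^ n"]
    by (simp add: t_def ip_scale_left norm_mult norm_power norm_divide power_divide)
  \<comment> \<open>The vectors \<open>u + t n\<close> and \<open>u - t n\<close> differ by
    \<open>2 t n\<close>, so at least one of them pairs with \<open>w n\<close> no less than
    \<open>t n\<close> does; the sign is chosen accordingly.\<close>
  define x where "x = rec_nat (0::'h) (\<lambda>n u. if cmod (ip (t n) (w n)) \<le> cmod (ip (u + t n) (w n)) then u + t n else u - t n)"
  have x_Suc: "x (Suc n) = (if cmod (ip (t n) (w n)) \<le> cmod (ip (x n + t n) (w n)) then x n + t n else x n - t n)" for n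
    by (simp add: x_def)
  have xV: "x n \<in> V" for n
  proof (induction n)
    case 0
    then show ?case using subspace_0[OF V_subspace] by (simp add: x_def)
  next
    case (Suc n)
    then show ?case unfolding x_Suc
      using subspace_add[OF V_subspace Suc tV] subspace_diff[OF V_subspace Suc tV] by simp
  qed
  have x_large: "cmod (ip (t n) (w n)) \<le> cmod (ip (x (Suc n)) (w n))" for n
  proof (cases "cmod (ip (t n) (w n)) \<le> cmod (ip (x n + t n) (w n))")
    case False
    have "2 * ip (t n) (w n) = ip (x n + t n) (w n) - ip (x n - t n) (w n)"
      by (simp add: ip_add_left ip_diff_left)
    then have "cmod (2 * ip (t n) (w n)) \<le> cmod (ip (x n + t n) (w n)) + cmod (ip (x n - t n) (w n))"
      by (simp only: norm_triangle_ineq4)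
    then show ?thesis using False by (simp add: x_Suc norm_mult)
  qed (simp add: x_Suc)
  have x_step: "Np (x (Suc n) - x n) \<le> (1/3) ^ n" for n
  proof -
    have "Np (0 - t n) = Np (t n - 0)" by (rule Np_commute[OF subspace_0[OF V_subspace] tV])
    then show ?thesis using t_small[of n] by (simp add: x_Suc)
  qed
  \<comment> \<open>The right side is the exact partial geometric sum, which lets the induction
    close; dropping the last factor gives the remainder \<open>1/2 * 3^-n\<close>.\<close>
  have x_tail: "Np (x (Suc n + j) - x (Suc n)) \<le> (1/2) * (1/3) ^ n * (1 - (1/3) ^ j)" for n j
  proof (induction j)
    case 0
    then show ?case
      using form_zero_left[OF p_form subspace_0[OF V_subspace]] by (simp add: Np_def)
  next
    case (Suc j)
    have "Np (x (Suc n + Suc j) - x (Suc n))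
        \<le> Np (x (Suc n + Suc j) - x (Suc n + j)) + Np (x (Suc n + j) - x (Suc n))"
      by (rule Np_triangle[OF xV xV xV])
    also have "\<dots> \<le> (1/3) ^ (Suc n + j) + (1/2) * (1/3) ^ n * (1 - (1/3) ^ j)"
      using x_step[of "Suc n + j"] Suc by simp
    also have "\<dots> = (1/2) * (1/3) ^ n * (1 - (1/3) ^ Suc j)"
      by (simp add: power_add field_simps)
    finally show ?case .
  qed
  have x_tail': "Np (x m - x (Suc n)) \<le> (1/2) * (1/3) ^ n" if "m \<ge> Suc n" for m n
  proof -
    from le_Suc_ex[OF that] obtain j where j: "m = Suc n + j" by (rule exE)
    have "(1/2) * (1/3) ^ n * (1 - (1/3) ^ j) \<le> (1/2) * (1/3) ^ n * (1::real)"
      by (intro mult_left_mono) auto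
    then show ?thesis using order_trans[OF x_tail[of n j]] j by (simp only: mult_1_right)
  qed
  have "\<exists>u\<in>V. (\<lambda>n. Re (p (x n - u) (x n - u))) \<longlonglongrightarrow> 0"
  proof (rule p_complete[OF xV])
    fix e :: real assume e: "e > 0"
    obtain N where N: "(1/3) ^ N < sqrt e"
      using real_arch_pow_inv[of "sqrt e" "1/3"] e by auto
    have "Re (p (x n - x m) (x n - x m)) < e" if "m \<ge> Suc N" "n \<ge> Suc N" for m n
    proof -
      have "Np (x n - x m) \<le> Np (x n - x (Suc N)) + Np (x (Suc N) - x m)"
        by (rule Np_triangle[OF xV xV xV])
      also have "Np (x (Suc N) - x m) = Np (x m - x (Suc N))" by (rule Np_commute[OF xV xV])
      also have "Np (x n - x (Suc N)) + \<dots> \<le> (1/3) ^ N"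
        using x_tail'[OF that(1)] x_tail'[OF that(2)] by simp
      finally have "Np (x n - x m) < sqrt e" using N by simp
      then show ?thesis by (simp add: Np_def)
    qed
    then show "\<exists>N. \<forall>m\<ge>N. \<forall>n\<ge>N. Re (p (x n - x m) (x n - x m)) < e" by blast
  qed
  then obtain u where uV: "u \<in> V" and u: "(\<lambda>n. Re (p (x n - u) (x n - u))) \<longlonglongrightarrow> 0" by blast
  have Np_lim: "(\<lambda>n. Np (x n - u)) \<longlonglongrightarrow> 0"
    unfolding Np_def using tendsto_real_sqrt[OF u] by simp
  have u_close: "Np (u - x (Suc n)) \<le> (1/2) * (1/3) ^ n" for n
  proof (rule tendsto_lowerbound)
    show "(\<lambda>m. Np (x m - u) + (1/2) * (1/3) ^ n) \<longlonglongrightarrow> (1/2) * (1/3) ^ n"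
      using tendsto_add[OF Np_lim tendsto_const[of "(1/2) * (1/3) ^ n"]] by simp
    show "eventually (\<lambda>m. Np (u - x (Suc n)) \<le> Np (x m - u) + (1/2) * (1/3) ^ n) sequentially"
      using eventually_ge_at_top[of "Suc n"]
    proof eventually_elim
      case (elim m)
      show ?case
        using Np_triangle[OF uV xV[of m] xV[of "Suc n"]] x_tail'[OF elim] Np_commute[OF uV xV[of m]]
        by simp
    qed
  qed simp
  have u_large: "(4/3) ^ n / 6 \<le> cmod (ip u (w n))" for n
  proof -
    have "cmod (ip (u - x (Suc n)) (w n)) \<le> op (w n) * ((1/2) * (1/3) ^ n)"
      using op_bound[OF V_diff[OF uV xV[of "Suc n"]], of "w n"] mult_left_mono[OF u_close[of n] less_imp_le[OF op_pos[of n]]]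
      by linarith
    moreover have "cmod (ip (x (Suc n)) (w n)) \<le> cmod (ip u (w n)) + cmod (ip (u - x (Suc n)) (w n))"
      using norm_triangle_ineq4[of "ip u (w n)" "ip (u - x (Suc n)) (w n)"] by (simp add: ip_diff_left)
    moreover have "4 ^ n * (1/3) ^ n \<le> op (w n) * (1/3) ^ n"
      using w_large[of n] by (intro mult_right_mono) auto
    moreover have "(4/3) ^ n = (4::real) ^ n * (1/3) ^ n"
      by (simp add: power_divide)
    ultimately show ?thesis using t_large[of n] x_large[of n] by linarith
  qed
  obtain M where M: "\<And>w. w \<in> W \<Longrightarrow> cmod (ip u w) \<le> M" using pw uV by blast
  obtain n where "6 * M < (4/3) ^ n" using real_arch_pow[of "4/3" "6 * M"] by auto
  then show False using M[OF wW[of n]] u_large[of n] by simp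
qed

end

subsection \<open>Min-max counting and equivalence of form norms\<close>

context self_adjoint_with_form
begin

text \<open>If the span of the nonpositive eigenvectors had dimension above \<open>card B\<close>,
  it would contain a nonzero vector orthogonal to \<open>B\<close>, on which the form would be both
  nonpositive and positive.\<close>

lemma neg_count_plus_kernel_le:
  assumes B: "finite B" "orthonormal B"
    and pos: "\<And>y. y \<in> V \<Longrightarrow> y \<noteq> 0 \<Longrightarrow> (\<forall>e\<in>B. ip y e = 0) \<Longrightarrow> Re (a y y) > 0"
  shows "neg_count sc D A + dim (eigenspace_op sc D A 0) \<le> card B"
proof -
  obtain Bm B0 \<kappa> where S: "finite Bm" "finite B0" "Bm \<inter> B0 = {}" "orthonormal (Bm \<union> B0)"
    "card Bm = neg_count sc D A" "card B0 = dim (eigenspace_op sc D A 0)" "span (Bm \<union> B0) \<subseteq> D"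
    "\<forall>y\<in>span (Bm \<union> B0). Re (a y y) \<le> 0"
    using nonpos_spectral_basis by (elim exE conjE)
  have "card (Bm \<union> B0) \<le> card B"
  proof (rule ccontr)
    assume "\<not> ?thesis"
    then have "card B < card (Bm \<union> B0)" by simp
    from exists_orthogonal_in_span[OF B(2,1) orthonormal_independent[OF S(4)] this]
    obtain y where y: "y \<in> span (Bm \<union> B0)" "y \<noteq> 0" "\<forall>e\<in>B. ip y e = 0" by blast
    then have "Re (a y y) > 0" using S(7) D_subset_V by (intro pos) auto
    then show False using S(8) y(1) by force
  qed
  then show ?thesis using card_Un_disjoint[OF S(1-3)] S(5,6) by simp
qed

text \<open>The dual count: a space of larger dimension than \<open>neg_count\<close> contains a
  nonzero vector orthogonal to all negative eigenvectors, and there the form is nonnegative.\<close>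

lemma neg_count_ge:
  assumes C: "independent C" "span C \<subseteq> V"
    and neg: "\<And>y. y \<in> span C \<Longrightarrow> y \<noteq> 0 \<Longrightarrow> Re (a y y) < 0"
  shows "card C \<le> neg_count sc D A"
proof (rule ccontr)
  assume less: "\<not> ?thesis"
  obtain Bm B0 \<kappa> where S: "finite Bm" "orthonormal (Bm \<union> B0)" "card Bm = neg_count sc D A"
    "\<forall>y\<in>V. (\<forall>e\<in>Bm. ip y e = 0) \<longrightarrow> 0 \<le> Re (a y y)"
    using nonpos_spectral_basis by (elim exE conjE)
  have on: "orthonormal Bm" by (rule orthonormal_subset[OF S(2)]) auto
  have "card Bm < card C" using less S(3) by simp
  from exists_orthogonal_in_span[OF on S(1) C(1) this]
  obtain y where y: "y \<in> span C" "y \<noteq> 0" "\<forall>e\<in>Bm. ip y e = 0" by blast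
  then have "0 \<le> Re (a y y)" using S(4) C(2) by blast
  then show False using neg[OF y(1,2)] by simp
qed

text \<open>By convention \<open>dim\<close> is zero for infinite-dimensional spaces as well; the
  finite basis \<open>B0\<close> of the kernel rules that case out.\<close>

lemma kernel_dim_eq_0_iff: "dim (eigenspace_op sc D A 0) = 0 \<longleftrightarrow> eigenspace_op sc D A 0 = {0}"
proof -
  obtain Bm B0 \<kappa> where S: "finite B0" "card B0 = dim (eigenspace_op sc D A 0)"
    "span B0 = eigenspace_op sc D A 0"
    using nonpos_spectral_basis by (elim exE conjE)
  show ?thesis
  proof
    assume "dim (eigenspace_op sc D A 0) = 0"
    then have "B0 = {}" using S(1,2) by simp
    then show "eigenspace_op sc D A 0 = {0}" using S(3) by simp
  next
    assume "eigenspace_op sc D A 0 = {0}"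
    then have "dim (eigenspace_op sc D A 0) = dim (span {})" by simp
    then show "dim (eigenspace_op sc D A 0) = 0" unfolding dim_span
      using dim_eq_card_independent[OF independent_empty] by simp
  qed
qed

text \<open>Reverses the domination \<open>le\<close> of \<open>p\<close> by
  \<open>q = a' - c ip\<close>. For \<open>z\<close> in \<open>D'\<close> with
  \<open>q[z] \<le> 1\<close>, the functional \<open>q z y\<close> of \<open>y\<close> is the
  pairing with the ambient vector \<open>(A' - c) z\<close> and hence \<open>p\<close>-bounded.
  Cauchy-Schwarz for \<open>q\<close> bounds these functionals at each fixed \<open>y\<close>, so
  uniform boundedness bounds them jointly. Testing with \<open>z = x / sqrt q[x]\<close> at
  \<open>y = x\<close> gives the estimate on \<open>D'\<close>; density extends it to
  \<open>V\<close>, where \<open>le\<close> controls the \<open>p\<close>-error.\<close>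

lemma form_norm_comparison:
  assumes T: "self_adjoint_with_form sc ip D' A' V a'"
    and nn: "\<And>y. y \<in> V \<Longrightarrow> c * (nrm y)\<^sup>2 \<le> Re (a' y y)"
    and le: "\<And>y. y \<in> V \<Longrightarrow> Re (p y y) \<le> C * (Re (a' y y) - c * (nrm y)\<^sup>2)"
  shows "\<exists>M\<ge>0. \<forall>y\<in>V. Re (a' y y) - c * (nrm y)\<^sup>2 \<le> M * Re (p y y)"
proof -
  interpret T: self_adjoint_with_form sc ip D' A' V a' by (rule T)
  define q where "q x y = a' x y + of_real (- c) * ip x y" for x y
  have q_form: "hermitian_form sc V q"
    unfolding q_def by (rule hermitian_form_add_ip[OF T.a_form])
  have Re_q: "Re (q y y) = Re (a' y y) - c * (nrm y)\<^sup>2" for y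
    by (simp add: q_def ip_self)
  have q_nonneg: "0 \<le> Re (q y y)" if "y \<in> V" for y using nn[OF that] by (simp add: Re_q)
  define W where "W = {A' z - sc (of_real c) z |z. z \<in> D' \<and> Re (q z z) \<le> 1}"
  have q_ip: "cmod (ip y (A' z - sc (of_real c) z)) = cmod (q z y)" if "y \<in> V" "z \<in> D'" for y z
  proof -
    have "q z y = ip (A' z - sc (of_real c) z) y"
      using T.a_representation[OF that(2,1)] by (simp add: q_def ip_diff_left ip_scale_left)
    then have "ip y (A' z - sc (of_real c) z) = cnj (q z y)"
      by (metis ip_sym)
    then show ?thesis by simp
  qed
  have "\<forall>y\<in>V. \<exists>M. \<forall>w\<in>W. cmod (ip y w) \<le> M"
  proof (intro exI ballI)
    fix y w assume y: "y \<in> V" and "w \<in> W"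
    then obtain z where z: "w = A' z - sc (of_real c) z" "z \<in> D'" "Re (q z z) \<le> 1"
      unfolding W_def by blast
    have zV: "z \<in> V" using z T.D_subset_V by blast
    have "cmod (ip y w) \<le> sqrt (Re (q z z)) * sqrt (Re (q y y))"
      unfolding z(1) q_ip[OF y z(2)] by (rule form_Cauchy_Schwarz_sqrt[OF q_form q_nonneg zV y])
    also have "\<dots> \<le> 1 * sqrt (Re (q y y))"
      using z(3) q_nonneg[OF y] by (intro mult_right_mono) auto
    finally show "cmod (ip y w) \<le> sqrt (Re (q y y))" by simp
  qed
  from form_norm_uniform_bound[OF this]
  obtain M where M: "M \<ge> 0" "\<forall>y\<in>V. \<forall>w\<in>W. cmod (ip y w) \<le> M * sqrt (Re (p y y))"
    by (elim exE conjE)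
  have bound_D: "sqrt (Re (q x x)) \<le> M * sqrt (Re (p x x))" if x: "x \<in> D'" for x
  proof (cases "Re (q x x) = 0")
    case True
    have "0 \<le> M * sqrt (Re (p x x))"
      using M(1) p_nonneg x T.D_subset_V by auto
    then show ?thesis by (simp add: True)
  next
    case False
    have xV: "x \<in> V" using x T.D_subset_V by blast
    define r where "r = sqrt (Re (q x x))"
    have r: "r > 0" using q_nonneg[OF xV] False by (simp add: r_def)
    have r2: "r\<^sup>2 = Re (q x x)" using q_nonneg[OF xV] by (simp add: r_def)
    let ?z = "sc (of_real (1 / r)) x"
    have z: "?z \<in> D'" by (rule subspace_scale[OF T.D_subspace x])
    have "Re (q ?z ?z) = 1"
      using form_square_scale[OF q_form xV, of "of_real (1 / r)"] r r2[symmetric]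
      by (simp add: norm_divide power_divide)
    then have "A' ?z - sc (of_real c) ?z \<in> W" unfolding W_def using z by fastforce
    then have "cmod (q ?z x) \<le> M * sqrt (Re (p x x))"
      using M(2) xV q_ip[OF xV z] by fastforce
    moreover have "Re (q ?z x) = r"
      using form_scale_left[OF q_form xV xV, of "of_real (1 / r)"] r r2[symmetric]
      by (simp add: power2_eq_square)
    ultimately show ?thesis
      using complex_Re_le_cmod[of "q ?z x"] unfolding r_def by linarith
  qed
  define K where "K = 1 + \<bar>1 - T.lb + c\<bar>"
  have K: "K > 0" by (simp add: K_def)
  have q_le: "Re (q y y) \<le> K * Re (T.p y y)" if y: "y \<in> V" for y
  proof -
    have "Re (q y y) = Re (T.p y y) - (1 - T.lb + c) * (nrm y)\<^sup>2"
      by (simp add: Re_q T.Re_p algebra_simps)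
    also have "\<dots> \<le> Re (T.p y y) + \<bar>1 - T.lb + c\<bar> * (nrm y)\<^sup>2"
      using abs_ge_minus_self[of "(1 - T.lb + c) * (nrm y)\<^sup>2"] by (simp add: abs_mult)
    also have "\<dots> \<le> Re (T.p y y) + \<bar>1 - T.lb + c\<bar> * Re (T.p y y)"
      using T.p_ge[OF y] by (intro add_left_mono mult_left_mono) auto
    finally show ?thesis by (simp add: K_def distrib_right)
  qed
  have bound_V: "sqrt (Re (q y y)) \<le> M * sqrt (Re (p y y))" if y: "y \<in> V" for y
  proof (rule field_le_epsilon)
    fix e :: real assume e: "e > 0"
    \<comment> \<open>Replacing \<open>y\<close> by \<open>x\<close> costs at most
      \<open>e / G\<close> in the \<open>q\<close>-norm and \<open>sqrt (max C 0) * (e / G)\<close>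
      in the \<open>p\<close>-norm, the latter multiplied by \<open>M\<close>; \<open>G\<close>
      makes the total \<open>e\<close>.\<close>
    define G where "G = M * sqrt (max C 0) + 1"
    have G: "G > 0" using M(1) by (simp add: G_def add_nonneg_pos)
    define d where "d = (e / G)\<^sup>2 / K"
    have "d > 0" using e G K by (simp add: d_def)
    then obtain x where x: "x \<in> D'" "Re (T.p (x - y) (x - y)) < d" using T.D_core[OF y] by blast
    have xV: "x \<in> V" using x T.D_subset_V by blast
    have xyV: "x - y \<in> V" "y - x \<in> V" using xV y by (simp_all add: subspace_diff[OF V_subspace])
    have qpos: "0 \<le> Re (q (x - y) (x - y))" by (rule q_nonneg[OF xyV(1)])
    have "K * Re (T.p (x - y) (x - y)) \<le> K * d" using x(2) K by (intro mult_left_mono) auto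
    also have "\<dots> = (e / G)\<^sup>2" using K by (simp add: d_def)
    finally have q_small: "Re (q (x - y) (x - y)) \<le> (e / G)\<^sup>2" using q_le[OF xyV(1)] by simp
    then have q_small': "sqrt (Re (q (x - y) (x - y))) \<le> e / G"
      using e G by (intro real_le_lsqrt) (auto simp: qpos)
    have "Re (p (x - y) (x - y)) \<le> C * Re (q (x - y) (x - y))"
      using le[OF xyV(1)] by (simp add: Re_q)
    also have "\<dots> \<le> max C 0 * Re (q (x - y) (x - y))" using qpos by (intro mult_right_mono) auto
    finally have "sqrt (Re (p (x - y) (x - y))) \<le> sqrt (max C 0) * sqrt (Re (q (x - y) (x - y)))"
      by (simp flip: real_sqrt_mult)
    also have "\<dots> \<le> sqrt (max C 0) * (e / G)" using q_small' by (intro mult_left_mono) auto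
    finally have p_small: "sqrt (Re (p (x - y) (x - y))) \<le> sqrt (max C 0) * (e / G)" .
    have "sqrt (Re (q y y)) \<le> sqrt (Re (q x x)) + sqrt (Re (q (y - x) (y - x)))"
      using form_triangle[OF q_form q_nonneg xV xyV(2)] by simp
    also have "q (y - x) (y - x) = q (x - y) (x - y)" by (rule form_square_minus_commute[OF q_form y xV])
    also have "sqrt (Re (q x x)) \<le> M * sqrt (Re (p x x))" by (rule bound_D[OF x(1)])
    also have "sqrt (Re (p x x)) \<le> sqrt (Re (p y y)) + sqrt (Re (p (x - y) (x - y)))"
      using form_triangle[OF p_form p_nonneg y xyV(1)] by simp
    finally have "sqrt (Re (q y y)) \<le> M * (sqrt (Re (p y y)) + sqrt (Re (p (x - y) (x - y))))
        + sqrt (Re (q (x - y) (x - y)))" using M(1) by (simp add: mult_left_mono)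
    also have "\<dots> \<le> M * (sqrt (Re (p y y)) + sqrt (max C 0) * (e / G)) + e / G"
      using p_small q_small' M(1) by (intro add_mono mult_left_mono) auto
    also have "\<dots> = M * sqrt (Re (p y y)) + G * (e / G)" by (simp add: G_def algebra_simps add_divide_distrib)
    also have "\<dots> = M * sqrt (Re (p y y)) + e" using G by simp
    finally show "sqrt (Re (q y y)) \<le> M * sqrt (Re (p y y)) + e" .
  qed
  have "Re (a' y y) - c * (nrm y)\<^sup>2 \<le> M\<^sup>2 * Re (p y y)" if y: "y \<in> V" for y
  proof -
    have "(sqrt (Re (q y y)))\<^sup>2 \<le> (M * sqrt (Re (p y y)))\<^sup>2"
      using bound_V[OF y] q_nonneg[OF y] by (intro power_mono) auto
    then show ?thesis using q_nonneg[OF y] p_nonneg[OF y] by (simp add: power_mult_distrib Re_q)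
  qed
  then show ?thesis by (intro exI[of _ "M\<^sup>2"]) simp
qed

end

subsection \<open>The jump of the negative count\<close>

locale differentiable_form_family = complex_hilbert_space sc ip
  for sc :: "complex \<Rightarrow> 'h::ab_group_add \<Rightarrow> 'h" and ip :: "'h \<Rightarrow> 'h \<Rightarrow> complex" +
  fixes \<sigma> \<tau> :: real and DF :: "real \<Rightarrow> 'h set" and F :: "real \<Rightarrow> 'h \<Rightarrow> 'h"
    and V :: "'h set" and f f' :: "real \<Rightarrow> 'h \<Rightarrow> 'h \<Rightarrow> complex" and ls c \<delta> C :: real
  assumes operator: "l \<in> {\<sigma><..<\<tau>} \<Longrightarrow> self_adjoint_with_form sc ip (DF l) (F l) V (f l)"
    and ls: "ls \<in> {\<sigma><..<\<tau>}"
    and \<delta>_pos: "\<delta> > 0"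
    and coercive: "y \<in> V \<Longrightarrow> \<delta> * (hnorm ip y)\<^sup>2 \<le> Re (f ls y y) - c * (hnorm ip y)\<^sup>2"
    and C_pos: "C > 0"
    and f'_bound: "l \<in> {\<sigma><..<\<tau>} \<Longrightarrow> y \<in> V \<Longrightarrow> \<bar>Re (f' l y y)\<bar> \<le> C * (Re (f ls y y) - c * (hnorm ip y)\<^sup>2)"
    and f_deriv: "y \<in> V \<Longrightarrow> l \<in> {\<sigma><..<\<tau>} \<Longrightarrow> ((\<lambda>t. Re (f t y y)) has_real_derivative Re (f' l y y)) (at l)"
    and eigen_neg: "l \<in> {\<sigma><..<\<tau>} \<Longrightarrow> y \<in> DF l \<Longrightarrow> y \<noteq> 0 \<Longrightarrow> F l y = 0 \<Longrightarrow> Re (f' l y y) < 0"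
begin

abbreviation I :: "real set" where "I \<equiv> {\<sigma><..<\<tau>}"

lemma f_form: "l \<in> I \<Longrightarrow> hermitian_form sc V (f l)"
  using self_adjoint_with_form.a_form[OF operator] .

lemma V_subspace: "subspace V"
  by (rule form_subspace[OF f_form[OF ls]])

text \<open>The square of the single reference norm in which the derivative bound is given; all
  changes with the parameter are measured in it.\<close>

definition q :: "'h \<Rightarrow> 'h \<Rightarrow> complex" where "q x y = f ls x y + of_real (- c) * ip x y"

lemma q_form: "hermitian_form sc V q"
  unfolding q_def by (rule hermitian_form_add_ip[OF f_form[OF ls]])

lemma Re_q: "Re (q y y) = Re (f ls y y) - c * (nrm y)\<^sup>2"
  by (simp add: q_def ip_self)

lemma q_ge: "y \<in> V \<Longrightarrow> \<delta> * (nrm y)\<^sup>2 \<le> Re (q y y)"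
  using coercive by (simp add: Re_q)

lemma q_nonneg: "y \<in> V \<Longrightarrow> 0 \<le> Re (q y y)"
  using q_ge[of y] \<delta>_pos by (meson mult_nonneg_nonneg less_imp_le order_trans zero_le_power2)

lemma q_pos: "y \<in> V \<Longrightarrow> y \<noteq> 0 \<Longrightarrow> 0 < Re (q y y)"
proof -
  assume y: "y \<in> V" "y \<noteq> 0"
  then have "0 < \<delta> * (nrm y)\<^sup>2" using \<delta>_pos by simp
  also have "\<dots> \<le> Re (q y y)" using y(1) by (rule q_ge)
  finally show "0 < Re (q y y)" .
qed

text \<open>Mean value theorem for each fixed \<open>y\<close>. The Lipschitz constant is a multiple
  of \<open>q[y]\<close> because the derivative bound is uniform in the parameter.\<close>

lemma f_lipschitz:
  assumes "l \<in> I" "l0 \<in> I" "y \<in> V"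
  shows "\<bar>Re (f l y y) - Re (f l0 y y)\<bar> \<le> C * Re (q y y) * \<bar>l - l0\<bar>"
proof -
  have "norm (Re (f l y y) - Re (f l0 y y)) \<le> C * Re (q y y) * norm (l - l0)"
  proof (rule field_differentiable_bound[of I])
    fix t assume "t \<in> I"
    then show "((\<lambda>t. Re (f t y y)) has_field_derivative Re (f' t y y)) (at t within I)"
      using f_deriv[OF assms(3)] has_field_derivative_at_within by blast
    show "norm (Re (f' t y y)) \<le> C * Re (q y y)"
      using f'_bound[OF \<open>t \<in> I\<close> assms(3)] by (simp add: Re_q)
  qed (use assms in auto)
  then show ?thesis by simp
qed

text \<open>The Lipschitz bound shows that \<open>q\<close> dominates the form norm at
  \<open>l\<close>; \<open>form_norm_comparison\<close> reverses this. The result converts gaps of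
  \<open>F(l)\<close>, which are measured in the ambient norm, into gaps measured by
  \<open>q\<close>.\<close>

lemma garding:
  assumes l: "l \<in> I"
  shows "\<exists>M\<ge>0. \<exists>k\<ge>0. \<forall>y\<in>V. Re (q y y) \<le> M * (Re (f l y y) + k * (nrm y)\<^sup>2)"
proof -
  interpret L: self_adjoint_with_form sc ip "DF l" "F l" V "f l" by (rule operator[OF l])
  \<comment> \<open>The summands pay for \<open>q\<close> itself, for moving from \<open>ls\<close>
    to \<open>l\<close>, and for replacing the ambient norm by \<open>q\<close> through
    coercivity.\<close>
  define K where "K = 1 + C * \<bar>l - ls\<bar> + (\<bar>c\<bar> + \<bar>1 - L.lb\<bar>) / \<delta>"
  have "Re (L.p y y) \<le> K * (Re (f ls y y) - c * (nrm y)\<^sup>2)" if y: "y \<in> V" for y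
  proof -
    have "Re (f l y y) \<le> Re (f ls y y) + C * \<bar>l - ls\<bar> * Re (q y y)"
      using f_lipschitz[OF l ls y] by (simp add: mult_ac)
    moreover have "(c + (1 - L.lb)) * (nrm y)\<^sup>2 \<le> (\<bar>c\<bar> + \<bar>1 - L.lb\<bar>) * (Re (q y y) / \<delta>)"
    proof (rule mult_mono)
      show "(nrm y)\<^sup>2 \<le> Re (q y y) / \<delta>" using q_ge[OF y] \<delta>_pos by (simp add: field_simps)
    qed auto
    moreover have "Re (L.p y y) = Re (f l y y) - Re (f ls y y) + Re (q y y) + (c + (1 - L.lb)) * (nrm y)\<^sup>2"
      by (simp add: L.Re_p Re_q algebra_simps)
    moreover have "K * Re (q y y) = Re (q y y) + C * \<bar>l - ls\<bar> * Re (q y y)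
        + (\<bar>c\<bar> + \<bar>1 - L.lb\<bar>) * (Re (q y y) / \<delta>)"
      by (simp add: K_def distrib_right)
    ultimately show ?thesis unfolding Re_q[symmetric] by linarith
  qed
  from L.form_norm_comparison[OF operator[OF ls] _ this]
  obtain M where M: "M \<ge> 0" "\<forall>y\<in>V. Re (f ls y y) - c * (nrm y)\<^sup>2 \<le> M * Re (L.p y y)"
    using coercive \<delta>_pos by (smt (verit) mult_nonneg_nonneg zero_le_power2)
  have "Re (q y y) \<le> M * (Re (f l y y) + \<bar>1 - L.lb\<bar> * (nrm y)\<^sup>2)" if y: "y \<in> V" for y
  proof -
    have "Re (q y y) \<le> M * (Re (f l y y) + (1 - L.lb) * (nrm y)\<^sup>2)"
      using M(2) y by (simp add: Re_q L.Re_p)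
    also have "\<dots> \<le> M * (Re (f l y y) + \<bar>1 - L.lb\<bar> * (nrm y)\<^sup>2)"
      using M(1) by (intro mult_left_mono add_left_mono mult_right_mono) auto
    finally show ?thesis .
  qed
  then show ?thesis using M(1) by (intro exI[of _ M] exI[of _ "\<bar>1 - L.lb\<bar>"] conjI) auto
qed

section \<open>Difference quotients and their sign on the kernel\<close>

definition \<Delta> :: "real \<Rightarrow> real \<Rightarrow> 'h \<Rightarrow> 'h \<Rightarrow> complex" where
  "\<Delta> l0 l x y = (f l x y - f l0 x y) / of_real (l - l0)"

lemma \<Delta>_form:
  assumes "l \<in> I" "l0 \<in> I" shows "hermitian_form sc V (\<Delta> l0 l)"
  unfolding hermitian_form_def
proof (intro conjI ballI allI)
  fix x y assume "x \<in> V" "y \<in> V"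
  then show "\<Delta> l0 l y x = cnj (\<Delta> l0 l x y)"
    unfolding \<Delta>_def complex_cnj_divide complex_cnj_diff complex_cnj_complex_of_real
    using form_sym[OF f_form[OF assms(1)]] form_sym[OF f_form[OF assms(2)]] by metis
qed (use assms f_form in \<open>auto simp: V_subspace \<Delta>_def form_add_left[OF f_form] form_scale_left[OF f_form]
      add_divide_distrib diff_divide_distrib algebra_simps\<close>)

lemma Re_\<Delta>: "Re (\<Delta> l0 l y y) = (Re (f l y y) - Re (f l0 y y)) / (l - l0)"
  by (simp add: \<Delta>_def Re_divide_of_real del: of_real_diff)

lemma f_eq_\<Delta>: "l \<noteq> l0 \<Longrightarrow> Re (f l y y) = Re (f l0 y y) + (l - l0) * Re (\<Delta> l0 l y y)"
  by (simp add: Re_\<Delta>)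

lemma \<Delta>_bound:
  assumes "l \<in> I" "l0 \<in> I" "l \<noteq> l0" "y \<in> V"
  shows "\<bar>Re (\<Delta> l0 l y y)\<bar> \<le> C * Re (q y y)"
  using f_lipschitz[OF assms(1,2,4)] assms(3) by (simp add: Re_\<Delta> abs_divide field_simps)

text \<open>A small \<open>s\<close> protects the \<open>z\<close>-part at the price of a large
  constant on \<open>w\<close>. It will be chosen so that the loss on \<open>z\<close> is half of
  the negative amount available there.\<close>

lemma \<Delta>_add_le:
  assumes l: "l \<in> I" "l0 \<in> I" "l \<noteq> l0" and z: "z \<in> V" and w: "w \<in> V" and s: "s > 0"
  shows "Re (\<Delta> l0 l (z + w) (z + w))
      \<le> Re (\<Delta> l0 l z z) + C * s\<^sup>2 * Re (q z z) + (C / s\<^sup>2 + C) * Re (q w w)"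
proof -
  have "\<bar>2 * Re (\<Delta> l0 l z w)\<bar> \<le> C * (s\<^sup>2 * Re (q z z) + Re (q w w) / s\<^sup>2)"
    by (rule form_cross_bound[OF \<Delta>_form[OF l(1,2)] q_form \<Delta>_bound[OF l] z w s])
  moreover have "\<bar>Re (\<Delta> l0 l w w)\<bar> \<le> C * Re (q w w)" by (rule \<Delta>_bound[OF l w])
  ultimately show ?thesis
    unfolding form_square_add[OF \<Delta>_form[OF l(1,2)] z w] by (simp add: algebra_simps)
qed

text \<open>The derivative is negative on the kernel; compactness of its unit sphere (via the resolvent)
  makes the difference quotients uniformly negative.\<close>
lemma kernel_uniformly_decreasing:
  assumes l0: "l0 \<in> I"
  shows "\<exists>\<epsilon>>0. \<exists>\<kappa>>0. \<forall>l\<in>I. l \<noteq> l0 \<longrightarrow> \<bar>l - l0\<bar> < \<epsilon> \<longrightarrow>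
    (\<forall>z\<in>eigenspace_op sc (DF l0) (F l0) 0. Re (\<Delta> l0 l z z) \<le> - \<kappa> * Re (q z z))"
proof (rule ccontr)
  assume neg: "\<not> ?thesis"
  interpret L: self_adjoint_with_form sc ip "DF l0" "F l0" V "f l0" by (rule operator[OF l0])
  let ?K = "eigenspace_op sc (DF l0) (F l0) 0"
  have K: "z \<in> ?K \<longleftrightarrow> z \<in> DF l0 \<and> F l0 z = 0" for z by (simp add: eigenspace_op_def)
  have KV: "z \<in> V" if "z \<in> ?K" for z using that L.D_subset_V by (auto simp: K)
  have "\<exists>l z. l \<in> I \<and> l \<noteq> l0 \<and> \<bar>l - l0\<bar> < 1 / Suc n \<and> z \<in> ?K \<and>
      - (1 / Suc n) * Re (q z z) < Re (\<Delta> l0 l z z)" for n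
  proof (rule ccontr)
    assume "\<not> ?thesis"
    then have "\<forall>l\<in>I. l \<noteq> l0 \<longrightarrow> \<bar>l - l0\<bar> < 1 / Suc n \<longrightarrow>
      (\<forall>z\<in>?K. Re (\<Delta> l0 l z z) \<le> - (1 / Suc n) * Re (q z z))" using not_less by blast
    moreover have "1 / real (Suc n) > 0" by simp
    ultimately show False using neg by blast
  qed
  then obtain l z0 where lI: "\<And>n. l n \<in> I" and l_ne: "\<And>n. l n \<noteq> l0"
    and l_close: "\<And>n. \<bar>l n - l0\<bar> < 1 / Suc n" and z0K: "\<And>n. z0 n \<in> ?K"
    and z0_gt: "\<And>n. - (1 / Suc n) * Re (q (z0 n) (z0 n)) < Re (\<Delta> l0 (l n) (z0 n) (z0 n))"
    by metis
  have z0_ne: "z0 n \<noteq> 0" for n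
  proof
    assume "z0 n = 0"
    then show False
      using z0_gt[of n] form_zero_left[OF q_form subspace_0[OF V_subspace]]
        form_zero_left[OF \<Delta>_form[OF lI l0] subspace_0[OF V_subspace], of n] by simp
  qed
  define z where "z n = sc (of_real (1 / nrm (z0 n))) (z0 n)" for n
  have zK: "z n \<in> ?K" for n
    unfolding z_def by (rule subspace_scale[OF L.eigenspace_subspace z0K])
  have z1: "nrm (z n) = 1" for n
    using z0_ne[of n] by (simp add: z_def nrm_scale norm_divide)
  have z_gt: "- (1 / Suc n) * Re (q (z n) (z n)) < Re (\<Delta> l0 (l n) (z n) (z n))" for n
  proof -
    have pos: "(cmod (of_real (1 / nrm (z0 n))))\<^sup>2 > 0" using z0_ne[of n] by simp
    show ?thesis
      unfolding z_def form_square_scale[OF q_form KV[OF z0K]] form_square_scale[OF \<Delta>_form[OF lI l0] KV[OF z0K]]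
      using mult_strict_left_mono[OF z0_gt[of n] pos] by (simp only: mult_ac)
  qed
  obtain M k where Mk: "M \<ge> 0" "k \<ge> 0" "\<forall>y\<in>V. Re (q y y) \<le> M * (Re (f l0 y y) + k * (nrm y)\<^sup>2)"
    using garding[OF l0] by (elim exE conjE)
  \<comment> \<open>\<open>f l0\<close> vanishes on kernel vectors, so the Garding inequality bounds
    \<open>q\<close> by the ambient norm there, and ambient convergence in the kernel becomes
    \<open>q\<close>-convergence.\<close>
  have q_K: "Re (q y y) \<le> M * k * (nrm y)\<^sup>2" if y: "y \<in> ?K" for y
  proof -
    have "f l0 y y = 0" using y L.a_on_D[of y y] by (simp add: K)
    then show ?thesis using bspec[OF Mk(3) KV[OF y]] by (simp add: mult.assoc)
  qed
  obtain r u where r: "strict_mono r" and u: "hconv ip (\<lambda>n. L.R (z (r n))) u"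
    using L.R_compact[of z 1] z1 by auto
  \<comment> \<open>Since \<open>F l0\<close> annihilates \<open>z\<close>,
    \<open>(F l0 - \<i>) (\<i> z) = z\<close>: the resolvent is multiplication by
    \<open>\<i>\<close> on the kernel, and its compactness gives a convergent subsequence of
    \<open>z\<close>.\<close>
  have "L.R (z n) = sc \<i> (z n)" for n
  proof -
    have "L.R (F l0 (sc \<i> (z n)) - sc \<i> (sc \<i> (z n))) = sc \<i> (z n)"
      by (rule L.R_inverse) (use zK[of n] subspace_scale[OF L.D_subspace] in \<open>simp add: K\<close>)
    then show ?thesis using zK[of n] by (simp add: K L.A_scale)
  qed
  then have "hconv ip (\<lambda>n. sc \<i> (z (r n))) u" using u by simp
  from hconv_scale[OF this, of "- \<i>"] have zw: "hconv ip (\<lambda>n. z (r n)) (sc (- \<i>) u)" by simp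
  define w where "w = sc (- \<i>) u"
  have zw: "hconv ip (\<lambda>n. z (r n)) w" using zw by (simp add: w_def)
  have "(\<lambda>n. F l0 (z (r n))) = (\<lambda>n. 0)" using zK by (auto simp: K)
  moreover have "hconv ip (\<lambda>n. 0) 0" by (simp add: hconv_def)
  ultimately have "hconv ip (\<lambda>n. F l0 (z (r n))) 0" by simp
  then have wK: "w \<in> ?K" using L.A_closed[OF _ zw] zK by (simp add: K)
  have "nrm w = 1"
    using hconv_nrm[OF zw] by (simp add: z1 LIMSEQ_const_iff)
  then have w_ne: "w \<noteq> 0" by auto
  define d where "d = Re (f' l0 w w)"
  have d: "d < 0" unfolding d_def using eigen_neg[OF l0 _ w_ne] wK by (simp add: K)
  have qw: "Re (q w w) > 0" by (rule q_pos[OF KV[OF wK] w_ne])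
  \<comment> \<open>Makes the loss \<open>C * s^2 * q[w]\<close> equal to
    \<open>- d / 2\<close>.\<close>
  define s where "s = sqrt (- d / (2 * C * Re (q w w)))"
  have s: "s > 0" using d qw C_pos by (simp add: s_def divide_neg_pos)
  have s2: "C * s\<^sup>2 * Re (q w w) = - d / 2"
    using d qw C_pos by (simp add: s_def divide_nonpos_pos)
  define v where "v n = z (r n) - w" for n
  have vK: "v n \<in> ?K" for n unfolding v_def by (rule subspace_diff[OF L.eigenspace_subspace zK wK])
  have "(\<lambda>n. M * k * (nrm (v n))\<^sup>2) \<longlonglongrightarrow> M * k * 0\<^sup>2"
    unfolding v_def by (intro tendsto_intros hconvD[OF zw])
  then have "(\<lambda>n. M * k * (nrm (v n))\<^sup>2) \<longlonglongrightarrow> 0" by simp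
  then have qv: "(\<lambda>n. Re (q (v n) (v n))) \<longlonglongrightarrow> 0"
    by (rule Lim_null_comparison[rotated]) (use q_K[OF vK] q_nonneg[OF KV[OF vK]] in simp)
  have l_lim: "(\<lambda>n. l n) \<longlonglongrightarrow> l0"
  proof (rule LIM_zero_cancel)
    show "(\<lambda>n. l n - l0) \<longlonglongrightarrow> 0"
      by (rule Lim_null_comparison[OF _ LIMSEQ_inverse_real_of_nat])
        (use l_close in \<open>auto simp: inverse_eq_divide intro!: less_imp_le always_eventually\<close>)
  qed
  have "((\<lambda>t. (Re (f t w w) - Re (f l0 w w)) / (t - l0)) \<longlongrightarrow> d) (at l0)"
    using f_deriv[OF KV[OF wK] l0] unfolding d_def has_field_derivative_iff .
  moreover have "filterlim (\<lambda>n. l (r n)) (at l0) sequentially"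
    unfolding filterlim_at using LIMSEQ_subseq_LIMSEQ[OF l_lim r] l_ne by (simp add: o_def)
  ultimately have lim_d: "(\<lambda>n. Re (\<Delta> l0 (l (r n)) w w)) \<longlonglongrightarrow> d"
    unfolding Re_\<Delta> by (rule filterlim_compose)
  have lim_rhs: "(\<lambda>n. Re (\<Delta> l0 (l (r n)) w w) + C * s\<^sup>2 * Re (q w w) + (C / s\<^sup>2 + C) * Re (q (v n) (v n)))
      \<longlonglongrightarrow> d + C * s\<^sup>2 * Re (q w w) + (C / s\<^sup>2 + C) * 0"
    by (intro tendsto_intros lim_d qv)
  have "(\<lambda>n. 1 / real (Suc n)) \<longlonglongrightarrow> 0"
    using LIMSEQ_inverse_real_of_nat by (simp add: inverse_eq_divide)
  from tendsto_mult_right[OF LIMSEQ_subseq_LIMSEQ[OF this r], of "- (M * k)"]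
  have lim_lhs: "(\<lambda>n. - (M * k) * (1 / real (Suc (r n)))) \<longlonglongrightarrow> 0" by (simp add: o_def)
  \<comment> \<open>The fixed vector \<open>w\<close> carries the differentiability, and the
    vanishing \<open>v n\<close> absorbs the variation of the kernel vectors. The limit reads
    \<open>0 \<le> d / 2\<close>, against \<open>d < 0\<close>.\<close>
  have "0 \<le> d + C * s\<^sup>2 * Re (q w w) + (C / s\<^sup>2 + C) * 0"
  proof (rule LIMSEQ_le[OF lim_lhs lim_rhs], intro exI allI impI)
    fix n :: nat
    have "- (M * k) * (1 / real (Suc (r n))) \<le> - (1 / Suc (r n)) * Re (q (z (r n)) (z (r n)))"
      using q_K[OF zK, of "r n"] by (simp add: z1 divide_right_mono)
    also have "\<dots> \<le> Re (\<Delta> l0 (l (r n)) (w + v n) (w + v n))"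
      using z_gt[of "r n"] by (simp add: v_def)
    also have "\<dots> \<le> Re (\<Delta> l0 (l (r n)) w w) + C * s\<^sup>2 * Re (q w w) + (C / s\<^sup>2 + C) * Re (q (v n) (v n))"
      by (rule \<Delta>_add_le[OF lI l0 l_ne KV[OF wK] KV[OF vK] s])
    finally show "- (M * k) * (1 / real (Suc (r n)))
      \<le> Re (\<Delta> l0 (l (r n)) w w) + C * s\<^sup>2 * Re (q w w) + (C / s\<^sup>2 + C) * Re (q (v n) (v n))" .
  qed
  then show False using d s2 by simp
qed

text \<open>The weight with \<open>C * s^2 = \<kappa> / 2\<close> spends half of the decay on the
  cross term. \<open>C2 \<ge> C\<close> is recorded so that the same constant also bounds the
  difference quotient alone.\<close>

lemma kernel_decreasing_perturbed:
  assumes l0: "l0 \<in> I"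
  shows "\<exists>\<epsilon>>0. \<exists>\<kappa>>0. \<exists>C2\<ge>C. \<forall>l\<in>I. l \<noteq> l0 \<longrightarrow> \<bar>l - l0\<bar> < \<epsilon> \<longrightarrow>
    (\<forall>z\<in>eigenspace_op sc (DF l0) (F l0) 0. \<forall>w\<in>V.
      Re (\<Delta> l0 l (z + w) (z + w)) \<le> - \<kappa> * Re (q z z) + C2 * Re (q w w))"
proof -
  interpret L: self_adjoint_with_form sc ip "DF l0" "F l0" V "f l0" by (rule operator[OF l0])
  let ?K = "eigenspace_op sc (DF l0) (F l0) 0"
  have KV: "z \<in> V" if "z \<in> ?K" for z using that L.D_subset_V by (auto simp: eigenspace_op_def)
  obtain \<epsilon> \<kappa> where \<epsilon>: "\<epsilon> > 0" and \<kappa>: "\<kappa> > 0" and dec: "\<forall>l\<in>I. l \<noteq> l0 \<longrightarrow> \<bar>l - l0\<bar> < \<epsilon> \<longrightarrow>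
    (\<forall>z\<in>?K. Re (\<Delta> l0 l z z) \<le> - \<kappa> * Re (q z z))"
    using kernel_uniformly_decreasing[OF l0] by (elim exE conjE)
  define s where "s = sqrt (\<kappa> / (2 * C))"
  have s: "s > 0" using \<kappa> C_pos by (simp add: s_def)
  have s2: "C * s\<^sup>2 = \<kappa> / 2" using \<kappa> C_pos by (simp add: s_def)
  have "Re (\<Delta> l0 l (z + w) (z + w)) \<le> - (\<kappa> / 2) * Re (q z z) + (C / s\<^sup>2 + C) * Re (q w w)"
    if l: "l \<in> I" "l \<noteq> l0" "\<bar>l - l0\<bar> < \<epsilon>" and z: "z \<in> ?K" and w: "w \<in> V" for l z w
    using \<Delta>_add_le[OF l(1) l0 l(2) KV[OF z] w s] dec[rule_format, OF l z] unfolding s2 by simp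
  moreover have "C / s\<^sup>2 + C \<ge> C" using C_pos by simp
  moreover have "\<kappa> / 2 > 0" using \<kappa> by simp
  ultimately show ?thesis using \<epsilon> by blast
qed

section \<open>The local jump and the count along an interval\<close>

abbreviation ker_dim :: "real \<Rightarrow> nat" where
  "ker_dim l \<equiv> dim (eigenspace_op sc (DF l) (F l) 0)"

text \<open>Each side is a sandwich: a space on which the form at \<open>l\<close> is negative
  bounds \<open>neg_count\<close> from below, and positivity on its complement bounds
  \<open>neg_count + ker_dim\<close> from above by the same number. Equality forces
  \<open>ker_dim l = 0\<close>.\<close>

lemma local_jump:
  assumes l0: "l0 \<in> I"
  shows "\<exists>\<epsilon>>0. \<forall>l\<in>I. (l0 < l \<longrightarrow> l < l0 + \<epsilon> \<longrightarrow>
      nu_F sc DF F l = nu_F sc DF F l0 + ker_dim l0 \<and> ker_dim l = 0) \<and>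
    (l0 - \<epsilon> < l \<longrightarrow> l < l0 \<longrightarrow> nu_F sc DF F l = nu_F sc DF F l0 \<and> ker_dim l = 0)"
proof -
  interpret L: self_adjoint_with_form sc ip "DF l0" "F l0" V "f l0" by (rule operator[OF l0])
  let ?K = "eigenspace_op sc (DF l0) (F l0) 0"
  obtain Bm B0 \<kappa> where fin: "finite Bm" "finite B0" and disj: "Bm \<inter> B0 = {}"
    and on: "orthonormal (Bm \<union> B0)" and card_Bm: "card Bm = neg_count sc (DF l0) (F l0)"
    and card_B0: "card B0 = ker_dim l0" and BD: "span (Bm \<union> B0) \<subseteq> DF l0" and B0K: "span B0 = ?K"
    and \<kappa>: "\<kappa> > 0" and neg: "\<forall>y\<in>span Bm. Re (f l0 y y) \<le> - \<kappa> * (nrm y)\<^sup>2"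
    and pos: "\<forall>y\<in>V. (\<forall>e\<in>Bm \<union> B0. ip y e = 0) \<longrightarrow> \<kappa> * (nrm y)\<^sup>2 \<le> Re (f l0 y y)"
    using L.nonpos_spectral_basis by (elim exE conjE)
  obtain M k where M: "M \<ge> 0" and k: "k \<ge> 0"
    and G: "\<forall>y\<in>V. Re (q y y) \<le> M * (Re (f l0 y y) + k * (nrm y)\<^sup>2)"
    using garding[OF l0] by (elim exE conjE)
  obtain \<epsilon>1 \<kappa>1 C2 where \<epsilon>1: "\<epsilon>1 > 0" and \<kappa>1: "\<kappa>1 > 0" and C2: "C2 \<ge> C"
    and jump: "\<forall>l\<in>I. l \<noteq> l0 \<longrightarrow> \<bar>l - l0\<bar> < \<epsilon>1 \<longrightarrow> (\<forall>z\<in>?K. \<forall>w\<in>V.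
      Re (\<Delta> l0 l (z + w) (z + w)) \<le> - \<kappa>1 * Re (q z z) + C2 * Re (q w w))"
    using kernel_decreasing_perturbed[OF l0] by (elim exE conjE)
  have C2_pos: "C2 > 0" using C2 C_pos by simp
  have sub: "span Bm \<subseteq> span (Bm \<union> B0)" "span B0 \<subseteq> span (Bm \<union> B0)"
    by (auto intro!: span_mono)
  have BV: "y \<in> V" if "y \<in> span (Bm \<union> B0)" for y using that BD L.D_subset_V by blast
  have onm: "orthonormal Bm" and on0: "orthonormal B0"
    by (rule orthonormal_subset[OF on], blast)+
  \<comment> \<open>The gap \<open>\<kappa>\<close> and the Garding inequality give
    \<open>\<kappa> q \<le> M (\<kappa> + k)\<close> times the absolute value of the form on both
    definite parts; the \<open>+ 1\<close> keeps the denominator positive.\<close>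
  define \<kappa>2 where "\<kappa>2 = \<kappa> / (M * (\<kappa> + k) + 1)"
  have M1: "M * (\<kappa> + k) + 1 > 0" using M k \<kappa> by (simp add: add_nonneg_pos)
  have \<kappa>2: "\<kappa>2 > 0" using \<kappa> M1 by (simp add: \<kappa>2_def)
  have pos_q: "\<kappa>2 * Re (q y y) \<le> Re (f l0 y y)" if y: "y \<in> V" "\<forall>e\<in>Bm \<union> B0. ip y e = 0" for y
  proof -
    have ge: "\<kappa> * (nrm y)\<^sup>2 \<le> Re (f l0 y y)" using pos y by blast
    have "\<kappa> * Re (q y y) \<le> \<kappa> * (M * (Re (f l0 y y) + k * (nrm y)\<^sup>2))"
      using G y(1) \<kappa> by (intro mult_left_mono) auto
    also have "\<dots> = M * (\<kappa> * Re (f l0 y y) + k * (\<kappa> * (nrm y)\<^sup>2))" by (simp add: algebra_simps)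
    also have "\<dots> \<le> M * (\<kappa> * Re (f l0 y y) + k * Re (f l0 y y))"
      using M k ge by (intro mult_left_mono add_left_mono) auto
    also have "\<dots> \<le> M * (\<kappa> * Re (f l0 y y) + k * Re (f l0 y y)) + Re (f l0 y y)"
      using order_trans[OF _ ge, of 0] \<kappa> by simp
    also have "\<dots> = (M * (\<kappa> + k) + 1) * Re (f l0 y y)" by (simp add: algebra_simps)
    finally show ?thesis using M1 by (simp add: \<kappa>2_def pos_divide_le_eq mult.commute)
  qed
  have neg_q: "Re (f l0 y y) \<le> - \<kappa>2 * Re (q y y)" if y: "y \<in> span Bm" for y
  proof -
    have yV: "y \<in> V" using y sub BV by blast
    have le: "Re (f l0 y y) \<le> - \<kappa> * (nrm y)\<^sup>2" using neg y by blast
    moreover have "0 \<le> \<kappa> * (nrm y)\<^sup>2" using \<kappa> by simp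
    ultimately have f0: "Re (f l0 y y) \<le> 0" by linarith
    have "\<kappa> * Re (q y y) \<le> \<kappa> * (M * (Re (f l0 y y) + k * (nrm y)\<^sup>2))"
      using G yV \<kappa> by (intro mult_left_mono) auto
    also have "\<dots> = M * (\<kappa> * Re (f l0 y y) + k * (\<kappa> * (nrm y)\<^sup>2))" by (simp add: algebra_simps)
    also have "\<dots> \<le> M * (\<kappa> * (- Re (f l0 y y)) + k * (- Re (f l0 y y)))"
      using M k \<kappa> le f0 by (intro mult_left_mono add_mono) auto
    also have "\<dots> \<le> M * (\<kappa> * (- Re (f l0 y y)) + k * (- Re (f l0 y y))) + (- Re (f l0 y y))"
      using f0 by simp
    also have "\<dots> = (M * (\<kappa> + k) + 1) * (- Re (f l0 y y))" by (simp add: algebra_simps)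
    finally have "\<kappa> * Re (q y y) / (M * (\<kappa> + k) + 1) \<le> - Re (f l0 y y)"
      using M1 by (simp add: pos_divide_le_eq mult.commute)
    then show ?thesis by (simp add: \<kappa>2_def)
  qed
  \<comment> \<open>Under \<open>f l0\<close> a kernel vector pairs to zero with every vector of
    \<open>V\<close>, so no cross term arises at order zero.\<close>
  have f_ker: "Re (f l0 (z + w) (z + w)) = Re (f l0 w w)" if z: "z \<in> ?K" and w: "w \<in> V" for z w
  proof -
    have zD: "z \<in> DF l0" "F l0 z = 0" using z by (auto simp: eigenspace_op_def)
    have zV: "z \<in> V" using zD(1) L.D_subset_V by blast
    show ?thesis
      using form_square_add[OF L.a_form zV w] L.a_representation[OF zD(1) zV] L.a_representation[OF zD(1) w]
      by (simp add: zD(2))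
  qed
  have q0: "Re (q 0 0) = 0" using form_zero_left[OF q_form subspace_0[OF V_subspace]] by simp
  \<comment> \<open>Within this radius a change of the form by \<open>h * C2 * q\<close> stays below
    the gap \<open>\<kappa>2 * q\<close>.\<close>
  define \<epsilon> where "\<epsilon> = min \<epsilon>1 (\<kappa>2 / C2)"
  have \<epsilon>: "\<epsilon> > 0" using \<epsilon>1 \<kappa>2 C2_pos by (simp add: \<epsilon>_def)
  have small: "h * C2 < \<kappa>2" if "h < \<epsilon>" for h
    using that C2_pos by (simp add: \<epsilon>_def pos_less_divide_eq)
  have right: "nu_F sc DF F l = nu_F sc DF F l0 + ker_dim l0 \<and> ker_dim l = 0"
    if l: "l \<in> I" "l0 < l" "l < l0 + \<epsilon>" for l
  proof -
    interpret Ll: self_adjoint_with_form sc ip "DF l" "F l" V "f l" by (rule operator[OF l(1)])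
    define h where "h = l - l0"
    have h: "h > 0" "h * C2 < \<kappa>2" using l small[of h] by (auto simp: h_def)
    have ne: "l \<noteq> l0" using l by simp
    have f_le: "Re (f l (z + w) (z + w)) \<le> Re (f l0 w w) + h * (- \<kappa>1 * Re (q z z) + C2 * Re (q w w))"
      if "z \<in> ?K" "w \<in> V" for z w
    proof -
      have "Re (\<Delta> l0 l (z + w) (z + w)) \<le> - \<kappa>1 * Re (q z z) + C2 * Re (q w w)"
        using jump l that by (simp add: \<epsilon>_def)
      then have "h * Re (\<Delta> l0 l (z + w) (z + w)) \<le> h * (- \<kappa>1 * Re (q z z) + C2 * Re (q w w))"
        using h(1) by (intro mult_left_mono) auto
      then show ?thesis using f_eq_\<Delta>[OF ne, of "z + w"] f_ker[OF that] by (simp add: h_def)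
    qed
    have "neg_count sc (DF l) (F l) + ker_dim l \<le> card (Bm \<union> B0)"
    proof (rule Ll.neg_count_plus_kernel_le[OF _ on])
      fix w assume w: "w \<in> V" "w \<noteq> 0" "\<forall>e\<in>Bm \<union> B0. ip w e = 0"
      have "C * Re (q w w) \<le> C2 * Re (q w w)" using C2 q_nonneg[OF w(1)] by (rule mult_right_mono)
      then have "- (C2 * Re (q w w)) \<le> Re (\<Delta> l0 l w w)" using \<Delta>_bound[OF l(1) l0 ne w(1)] by linarith
      then have "h * (- (C2 * Re (q w w))) \<le> h * Re (\<Delta> l0 l w w)" using h(1) by (intro mult_left_mono) auto
      moreover have "h * C2 * Re (q w w) < \<kappa>2 * Re (q w w)"
        using h(2) q_pos[OF w(1,2)] by (rule mult_strict_right_mono)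
      ultimately show "0 < Re (f l w w)"
        using f_eq_\<Delta>[OF ne, of w] pos_q[OF w(1,3)] by (simp add: h_def)
    qed (use fin in simp)
    moreover have "card (Bm \<union> B0) \<le> neg_count sc (DF l) (F l)"
    proof (rule Ll.neg_count_ge[OF orthonormal_independent[OF on]])
      fix y assume y: "y \<in> span (Bm \<union> B0)" "y \<noteq> 0"
      then obtain w z where wz: "w \<in> span Bm" "z \<in> ?K" "y = z + w"
        unfolding span_Un B0K by (auto simp: add.commute)
      have wV: "w \<in> V" using wz(1) sub BV by blast
      have zV: "z \<in> V" using wz(2) sub BV unfolding B0K[symmetric] by blast
      have "Re (f l y y) \<le> - \<kappa>2 * Re (q w w) + h * (- \<kappa>1 * Re (q z z) + C2 * Re (q w w))"
        using f_le[OF wz(2) wV] neg_q[OF wz(1)] wz(3) by simp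
      also have "\<dots> = - ((\<kappa>2 - h * C2) * Re (q w w) + h * \<kappa>1 * Re (q z z))" by (simp add: algebra_simps)
      also have "\<dots> < 0"
      proof (cases "w = 0")
        case True
        then have "Re (q z z) > 0" using y(2) wz(3) q_pos[OF zV] by simp
        then show ?thesis using h(1) \<kappa>1 by (simp add: True q0)
      next
        case False
        then have "(\<kappa>2 - h * C2) * Re (q w w) > 0" using q_pos[OF wV] h(2) by simp
        moreover have "h * \<kappa>1 * Re (q z z) \<ge> 0" using h(1) \<kappa>1 q_nonneg[OF zV] by simp
        ultimately show ?thesis by linarith
      qed
      finally show "Re (f l y y) < 0" .
    qed (use BV in blast)
    ultimately show ?thesis
      using card_Un_disjoint[OF fin disj] card_Bm card_B0 by (simp add: nu_F_def)
  qed
  have left: "nu_F sc DF F l = nu_F sc DF F l0 \<and> ker_dim l = 0"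
    if l: "l \<in> I" "l0 - \<epsilon> < l" "l < l0" for l
  proof -
    interpret Ll: self_adjoint_with_form sc ip "DF l" "F l" V "f l" by (rule operator[OF l(1)])
    define h where "h = l0 - l"
    have h: "h > 0" "h * C2 < \<kappa>2" using l small[of h] by (auto simp: h_def)
    have ne: "l \<noteq> l0" using l by simp
    have f_\<Delta>: "Re (f l y y) = Re (f l0 y y) - h * Re (\<Delta> l0 l y y)" for y
      using f_eq_\<Delta>[OF ne, of y] by (simp add: h_def algebra_simps)
    have f_ge: "Re (f l0 w w) - h * (- \<kappa>1 * Re (q z z) + C2 * Re (q w w)) \<le> Re (f l (z + w) (z + w))"
      if "z \<in> ?K" "w \<in> V" for z w
    proof -
      have "Re (\<Delta> l0 l (z + w) (z + w)) \<le> - \<kappa>1 * Re (q z z) + C2 * Re (q w w)"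
        using jump l that by (simp add: \<epsilon>_def)
      then have "h * Re (\<Delta> l0 l (z + w) (z + w)) \<le> h * (- \<kappa>1 * Re (q z z) + C2 * Re (q w w))"
        using h(1) by (intro mult_left_mono) auto
      then show ?thesis using f_\<Delta>[of "z + w"] f_ker[OF that] by simp
    qed
    have "neg_count sc (DF l) (F l) + ker_dim l \<le> card Bm"
    proof (rule Ll.neg_count_plus_kernel_le[OF fin(1) onm])
      fix y assume y: "y \<in> V" "y \<noteq> 0" "\<forall>e\<in>Bm. ip y e = 0"
      \<comment> \<open>\<open>y\<close> is orthogonal only to \<open>Bm\<close>; removing its
        kernel component leaves a \<open>w\<close> orthogonal to \<open>Bm \<union> B0\<close>,
        where the gap applies.\<close>
      define z where "z = proj B0 y"
      define w where "w = y - z"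
      have zB: "z \<in> span B0" unfolding z_def by (rule proj_in_span)
      then have zK: "z \<in> ?K" by (simp only: B0K)
      have zV: "z \<in> V" using zB sub BV by blast
      have wV: "w \<in> V" unfolding w_def by (rule subspace_diff[OF V_subspace y(1) zV])
      have "ip w e = 0" if e: "e \<in> Bm \<union> B0" for e
      proof (cases "e \<in> B0")
        case True
        then show ?thesis using ip_proj[OF on0 fin(2)] by (simp add: w_def z_def ip_diff_left)
      next
        case False
        then have eBm: "e \<in> Bm" using e by blast
        have "ip e b = 0" if "b \<in> B0" for b
          using on e that False unfolding orthonormal_def by (metis UnCI)
        then have "ip e z = 0" by (rule ip_span_orthogonal[OF _ zB])
        then have "ip z e = 0" using ip_sym[of z e] by simp
        then show ?thesis using y(3) eBm by (simp add: w_def ip_diff_left)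
      qed
      then have "\<kappa>2 * Re (q w w) \<le> Re (f l0 w w)" using pos_q[OF wV] by blast
      then have "(\<kappa>2 - h * C2) * Re (q w w) + h * \<kappa>1 * Re (q z z) \<le> Re (f l y y)"
        using f_ge[OF zK wV] by (simp add: w_def algebra_simps)
      moreover have "(\<kappa>2 - h * C2) * Re (q w w) + h * \<kappa>1 * Re (q z z) > 0"
      proof (cases "w = 0")
        case True
        then have "Re (q z z) > 0" using y(2) q_pos[OF zV] by (simp add: w_def)
        then show ?thesis using h(1) \<kappa>1 by (simp add: True q0)
      next
        case False
        then have "(\<kappa>2 - h * C2) * Re (q w w) > 0" using q_pos[OF wV] h(2) by simp
        moreover have "h * \<kappa>1 * Re (q z z) \<ge> 0" using h(1) \<kappa>1 q_nonneg[OF zV] by simp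
        ultimately show ?thesis by linarith
      qed
      ultimately show "0 < Re (f l y y)" by linarith
    qed
    moreover have "card Bm \<le> neg_count sc (DF l) (F l)"
    proof (rule Ll.neg_count_ge[OF orthonormal_independent[OF onm]])
      fix w assume w: "w \<in> span Bm" "w \<noteq> 0"
      have wV: "w \<in> V" using w(1) sub BV by blast
      have "C * Re (q w w) \<le> C2 * Re (q w w)" using C2 q_nonneg[OF wV] by (rule mult_right_mono)
      then have "- (C2 * Re (q w w)) \<le> Re (\<Delta> l0 l w w)" using \<Delta>_bound[OF l(1) l0 ne wV] by linarith
      then have "h * (- (C2 * Re (q w w))) \<le> h * Re (\<Delta> l0 l w w)" using h(1) by (intro mult_left_mono) auto
      moreover have "h * C2 * Re (q w w) < \<kappa>2 * Re (q w w)"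
        using h(2) q_pos[OF wV w(2)] by (rule mult_strict_right_mono)
      ultimately show "Re (f l w w) < 0"
        using f_\<Delta>[of w] neg_q[OF w(1)] by simp
    qed (use sub BV in blast)
    ultimately show ?thesis using card_Bm by (simp add: nu_F_def)
  qed
  show ?thesis using \<epsilon> left right by blast
qed

text \<open>Bisection: an additive property of intervals that holds for all short intervals around
  each point holds for the whole interval.\<close>

lemma eigenvalue_count:
  assumes "\<sigma> < \<xi>1" "\<xi>1 \<le> \<xi>2" "\<xi>2 < \<tau>"
  shows "int (N_F sc DF F \<xi>1 \<xi>2) = int (nu_F sc DF F \<xi>2) - int (nu_F sc DF F \<xi>1)"
proof -
  define S where "S x y = {l. x \<le> l \<and> l < y \<and> eigenspace_op sc (DF l) (F l) 0 \<noteq> {0}}" for x y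
  \<comment> \<open>Finiteness is carried along because an infinite sum would be zero and additivity
    would fail. The guards are there because short intervals around a point may leave the parameter
    range. Adding instead of subtracting keeps the identity in the naturals.\<close>
  define P where "P x y \<longleftrightarrow> \<sigma> < x \<longrightarrow> y < \<tau> \<longrightarrow> finite (S x y) \<and>
    (\<Sum>l\<in>S x y. ker_dim l) + nu_F sc DF F x = nu_F sc DF F y" for x y
  have "P \<xi>1 \<xi>2"
    using \<open>\<xi>1 \<le> \<xi>2\<close>
  proof (induction rule: Bolzano)
    case (trans a b c)
    have S_Un: "S a c = S a b \<union> S b c" and S_disj: "S a b \<inter> S b c = {}"
      using trans(3,4) by (auto simp: S_def)
    show ?case
      unfolding P_def
    proof (intro impI)
      assume ac: "\<sigma> < a" "c < \<tau>"
      then have "\<sigma> < b" "b < \<tau>" using trans(3,4) by auto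
      then have "finite (S a b)" "finite (S b c)"
        "(\<Sum>l\<in>S a b. ker_dim l) + nu_F sc DF F a = nu_F sc DF F b"
        "(\<Sum>l\<in>S b c. ker_dim l) + nu_F sc DF F b = nu_F sc DF F c"
        using trans(1,2) ac unfolding P_def by auto
      then show "finite (S a c) \<and> (\<Sum>l\<in>S a c. ker_dim l) + nu_F sc DF F a = nu_F sc DF F c"
        unfolding S_Un by (simp add: sum.union_disjoint[OF _ _ S_disj])
    qed
  next
    case (local x)
    then have x: "x \<in> I" using assms by auto
    obtain \<epsilon> where \<epsilon>: "\<epsilon> > 0"
      and right: "\<And>l. l \<in> I \<Longrightarrow> x < l \<Longrightarrow> l < x + \<epsilon> \<Longrightarrow>
        nu_F sc DF F l = nu_F sc DF F x + ker_dim x \<and> ker_dim l = 0"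
      and left: "\<And>l. l \<in> I \<Longrightarrow> x - \<epsilon> < l \<Longrightarrow> l < x \<Longrightarrow> nu_F sc DF F l = nu_F sc DF F x \<and> ker_dim l = 0"
      using local_jump[OF x] by blast
    show ?case
    proof (intro exI[of _ \<epsilon>] conjI allI impI)
      fix a b assume ab: "a \<le> x \<and> x \<le> b \<and> b - a < \<epsilon>"
      show "P a b"
        unfolding P_def
      proof (intro impI)
        assume bd: "\<sigma> < a" "b < \<tau>"
        have "eigenspace_op sc (DF l) (F l) 0 = {0}" if "a \<le> l" "l < b" "l \<noteq> x" for l
        proof -
          have l: "l \<in> I" using that bd by auto
          then have "ker_dim l = 0" using left[of l] right[of l] that ab by (cases "l < x") auto
          then show ?thesis
            using self_adjoint_with_form.kernel_dim_eq_0_iff[OF operator[OF l]] by simp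
        qed
        \<comment> \<open>The right endpoint is excluded, so \<open>x\<close> counts only if
          \<open>x < b\<close>. This matches the one-sided jump: \<open>nu_F\<close> is unchanged to
          the left of \<open>x\<close> and grows by the kernel dimension to the right.\<close>
        then have "S a b \<subseteq> (if x < b then {x} else {})"
          using ab by (auto simp: S_def)
        moreover have "ker_dim x = 0" if "x \<notin> S a b" "x < b"
        proof -
          have "eigenspace_op sc (DF x) (F x) 0 = {0}" using that ab by (simp add: S_def)
          then show ?thesis
            using self_adjoint_with_form.kernel_dim_eq_0_iff[OF operator[OF x]] by simp
        qed
        ultimately have sum: "finite (S a b)" "(\<Sum>l\<in>S a b. ker_dim l) = (if x < b then ker_dim x else 0)"
          by (auto simp: subset_singleton_iff split: if_splits)
        have "nu_F sc DF F a = nu_F sc DF F x"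
          using left[of a] ab bd x by (cases "a < x") auto
        moreover have "nu_F sc DF F b = nu_F sc DF F x + (if x < b then ker_dim x else 0)"
          using right[of b] ab bd x by (cases "x < b") auto
        ultimately show "finite (S a b) \<and> (\<Sum>l\<in>S a b. ker_dim l) + nu_F sc DF F a = nu_F sc DF F b"
          using sum by simp
      qed
    qed (rule \<epsilon>)
  qed
  then have "N_F sc DF F \<xi>1 \<xi>2 + nu_F sc DF F \<xi>1 = nu_F sc DF F \<xi>2"
    using assms by (simp add: P_def N_F_def S_def)
  then show ?thesis by linarith
qed

end

theorem theorem3:
  fixes sc :: "complex \<Rightarrow> 'h::ab_group_add \<Rightarrow> 'h"
    and ip :: "'h \<Rightarrow> 'h \<Rightarrow> complex"
    and \<sigma> \<tau> :: real
    and DF :: "real \<Rightarrow> 'h set" and F :: "real \<Rightarrow> 'h \<Rightarrow> 'h"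
    and Df :: "'h set"
    and f f' :: "real \<Rightarrow> 'h \<Rightarrow> 'h \<Rightarrow> complex"
  assumes H: "complex_hilbert sc ip"
    and A1: "\<forall>l0\<in>{\<sigma><..<\<tau>}. self_adjoint_op sc ip (DF l0) (F l0) \<and>
               compact_resolvent sc ip (DF l0) (F l0)"
    and A2: "\<forall>l0\<in>{\<sigma><..<\<tau>}. \<exists>\<mu>::real. \<exists>U. open U \<and> l0 \<in> U \<and> compact (closure U) \<and>
               closure U \<subseteq> {\<sigma><..<\<tau>} \<and>
               (\<forall>l1\<in>U. \<forall>y\<in>DF l1. Re (ip (F l1 y) y) - \<mu> * (hnorm ip y)\<^sup>2 \<ge> 0)"
    and A3: "\<forall>l0\<in>{\<sigma><..<\<tau>}. \<forall>e>0. \<exists>d>0. \<forall>l\<in>{\<sigma><..<\<tau>}. \<bar>l - l0\<bar> < d \<longrightarrow>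
               (\<forall>g. hnorm ip (resolvent_i sc (DF l) (F l) g - resolvent_i sc (DF l0) (F l0) g)
                      \<le> e * hnorm ip g)"
    and i_ii: "\<forall>l0\<in>{\<sigma><..<\<tau>}.
               is_form_closure sc ip (DF l0) (\<lambda>x y. ip (F l0 x) y) Df (f l0)"
    and iii: "\<forall>l0\<in>{\<sigma><..<\<tau>}. hermitian_form sc Df (f' l0)"
    and iv: "\<exists>ls\<in>{\<sigma><..<\<tau>}. \<exists>c::real. \<exists>\<delta>>0.
               (\<forall>y\<in>Df. Re (f ls y y) - c * (hnorm ip y)\<^sup>2 \<ge> \<delta> * (hnorm ip y)\<^sup>2) \<and>
               (\<exists>C. \<forall>l\<in>{\<sigma><..<\<tau>}. \<forall>y\<in>Df.
                  \<bar>Re (f' l y y)\<bar> \<le> C * (Re (f ls y y) - c * (hnorm ip y)\<^sup>2))"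
    and v: "\<forall>y0\<in>Df. \<forall>l\<in>{\<sigma><..<\<tau>}.
               ((\<lambda>t. Re (f t y0 y0)) has_real_derivative Re (f' l y0 y0)) (at l)"
    and vi: "\<forall>l0\<in>{\<sigma><..<\<tau>}. \<forall>y0. y0 \<in> DF l0 \<and> y0 \<noteq> 0 \<and> F l0 y0 = 0 \<longrightarrow>
               Re (f' l0 y0 y0) < 0"
  shows "\<forall>\<xi>1 \<xi>2. \<sigma> < \<xi>1 \<and> \<xi>1 \<le> \<xi>2 \<and> \<xi>2 < \<tau> \<longrightarrow>
           int (N_F sc DF F \<xi>1 \<xi>2) = int (nu_F sc DF F \<xi>2) - int (nu_F sc DF F \<xi>1)"
proof -
  obtain ls c \<delta> C where ls: "ls \<in> {\<sigma><..<\<tau>}" and \<delta>: "\<delta> > 0"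
    and coercive: "\<forall>y\<in>Df. \<delta> * (hnorm ip y)\<^sup>2 \<le> Re (f ls y y) - c * (hnorm ip y)\<^sup>2"
    and bound: "\<forall>l\<in>{\<sigma><..<\<tau>}. \<forall>y\<in>Df. \<bar>Re (f' l y y)\<bar> \<le> C * (Re (f ls y y) - c * (hnorm ip y)\<^sup>2)"
    using iv by (elim bexE exE conjE)
  have hs: "complex_hilbert_space sc ip" by (rule complex_hilbert_space.intro[OF H])
  \<comment> \<open>\<open>max C 1\<close> makes the constant positive, as the weights divide by it;
    enlarging it is allowed because coercivity makes the reference form nonnegative.\<close>
  have "differentiable_form_family sc ip \<sigma> \<tau> DF F Df f f' ls c \<delta> (max C 1)"
  proof (intro differentiable_form_family.intro differentiable_form_family_axioms.intro hs)
    fix l assume "l \<in> {\<sigma><..<\<tau>}"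
    then show "self_adjoint_with_form sc ip (DF l) (F l) Df (f l)"
      using A1 i_ii by (intro self_adjoint_with_form.intro self_adjoint_with_form_axioms.intro hs) auto
  next
    fix l y assume ly: "l \<in> {\<sigma><..<\<tau>}" "y \<in> Df"
    have "0 \<le> \<delta> * (hnorm ip y)\<^sup>2" using \<delta> by simp
    then have "0 \<le> Re (f ls y y) - c * (hnorm ip y)\<^sup>2" using coercive ly(2) by force
    then have "C * (Re (f ls y y) - c * (hnorm ip y)\<^sup>2) \<le> max C 1 * (Re (f ls y y) - c * (hnorm ip y)\<^sup>2)"
      by (intro mult_right_mono) auto
    then show "\<bar>Re (f' l y y)\<bar> \<le> max C 1 * (Re (f ls y y) - c * (hnorm ip y)\<^sup>2)"
      using bound ly by force
  qed (use ls \<delta> coercive v vi in auto)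
  then show ?thesis using differentiable_form_family.eigenvalue_count by blast
qed

end
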